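(* Let $F^*=\min_{x\in\operatorname{dom}\psi}[F(x):=f(x)+\psi(x)]$ be the composite convex problem described in the context. Suppose that $D>0$ satisfies $\|x-y\|\le D$ for all $x,y\in\operatorname{dom}\psi$, that the Hölder constant $L_\nu$ of $f$ is finite for at least one $\nu\in[0,1]$, and that $f$ is accessible via an unbiased stochastic gradient oracle $\hat g=(g,\xi)$ with bounded variance $\sigma^2<+\infty$ (as defined in the context). Let $(x_k)_{k\ge0}$ be generated by the Universal Stochastic Gradient Method (defined in the context), and let $\bar x_k:=\frac1k\sum_{i=1}^kx_i$. Then, for all $k\ge1$, $$\mathbb{E}[F(\bar x_k)]-F^*\le\inf_{\nu\in[0,1]}\frac{8L_\nu D^{1+\nu}}{k^{(1+\nu)/2}}+\frac{4\sigma D}{\sqrt k}.$$ Consequently, for any $\epsilon>0$, to reach $\mathbb{E}[F(\bar x_k)]-F^*\le\epsilon$ it suffices to make $$O\Bigl(\inf_{\nu\in[0,1]}\Bigl[\frac{L_\nu}{\epsilon}\Bigr]^{2/(1+\nu)}D^2+\frac{\sigma^2D^2}{\epsilon^2}\Bigr)$$ stochastic oracle calls, where $O(\cdot)$ hides an absolute constant.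
   Context: Norms: $\mathbb{R}^n$ carries the standard inner product $\langle\cdot,\cdot\rangle$, the norm $\|x\|=\langle Bx,x\rangle^{1/2}$ for a fixed symmetric positive definite matrix $B$, and the dual norm $\|s\|_*=\langle s,B^{-1}s\rangle^{1/2}$. Problem: $\psi:\mathbb{R}^n\to\mathbb{R}\cup\{+\infty\}$ is a proper closed convex function; $f:\mathbb{R}^n\to\mathbb{R}\cup\{+\infty\}$ is a closed convex function which is finite and subdifferentiable over an open set containing $\operatorname{dom}\psi=\{x:\psi(x)<+\infty\}$. Hölder constants: for $\nu\in[0,1]$, $$L_\nu:=\sup\Bigl\{\frac{\|g(x)-g(y)\|_*}{\|x-y\|^\nu}: x,y\in\operatorname{dom}\psi,\ x\ne y,\ g(x)\in\partial f(x),\ g(y)\in\partial f(y)\Bigr\}\in[0,+\infty].$$ Terms with $L_\nu=+\infty$ are interpreted as $+\infty$ in the infima. Stochastic gradient oracle: a pair $\hat g=(g,\xi)$ of a random variable $\xi$ and a mapping $g:\operatorname{dom}f\times\operatorname{Im}\xi\to\mathbb{R}^n$. Each time it is queried at a point $x\in\operatorname{dom}\psi$, it generates a fresh copy of $\xi$, independent of everything generated before, and returns $g(x,\xi)$ (written $s\sim\hat g(x)$). Unbiasedness with bounded variance means: for every $x\in\operatorname{dom}\psi$, $f'(x):=\mathbb{E}_\xi[g(x,\xi)]\in\partial f(x)$, and $\sigma^2:=\sup_{x\in\operatorname{dom}\psi}\mathbb{E}_\xi[\|g(x,\xi)-f'(x)\|_*^2]<+\infty$. Notation: $[t]_+=\max\{t,0\}$;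 $\mathbb{E}$ is the full expectation. Universal Stochastic Gradient Method: choose $x_0\in\operatorname{dom}\psi$, set $H_0:=0$, and sample $g_0\sim\hat g(x_0)$. For $k=0,1,\ldots$: 1. let $x_{k+1}$ be a solution (an arbitrary one if it is not unique) of $\min_{x\in\operatorname{dom}\psi}\{\langle g_k,x\rangle+\psi(x)+\frac{H_k}{2}\|x-x_k\|^2\}$; 2. sample $g_{k+1}\sim\hat g(x_{k+1})$; 3. set $$H_{k+1}:=H_k+\frac{[\hat\beta_{k+1}-\frac12H_kr_{k+1}^2]_+}{D^2+\frac12r_{k+1}^2},$$ where $r_{k+1}:=\|x_{k+1}-x_k\|$ and $\hat\beta_{k+1}:=\langle g_{k+1}-g_k,x_{k+1}-x_k\rangle$. *)

theory Defs
  imports "HOL-Probability.Probability"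
begin

section \<open>Norms\<close>

definition spd_matrix :: "real^'n^'n \<Rightarrow> bool" where
  "spd_matrix B \<longleftrightarrow> transpose B = B \<and> (\<forall>x. x \<noteq> 0 \<longrightarrow> (B *v x) \<bullet> x > 0)"

definition pnorm :: "real^'n^'n \<Rightarrow> real^'n \<Rightarrow> real" where
  "pnorm B x = sqrt ((B *v x) \<bullet> x)"

definition dnorm :: "real^'n^'n \<Rightarrow> real^'n \<Rightarrow> real" where
  "dnorm B s = sqrt (s \<bullet> (matrix_inv B *v s))"


section \<open>Extended-valued convex functions\<close>

definition edom :: "('a \<Rightarrow> ereal) \<Rightarrow> 'a set" where
  "edom h = {x. h x < \<infinity>}"

text \<open>The library's \<open>epigraph\<close> is for real-valued functions only.\<close>

definition eepigraph :: "('a \<Rightarrow> ereal) \<Rightarrow> ('a \<times> real) set" where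
  "eepigraph h = {(x, t). h x \<le> ereal t}"

definition closed_convex_fun :: "('a::euclidean_space \<Rightarrow> ereal) \<Rightarrow> bool" where
  "closed_convex_fun h \<longleftrightarrow>
     (\<forall>x. h x \<noteq> -\<infinity>) \<and> convex (eepigraph h) \<and> closed (eepigraph h)"

text \<open>The subdifferential is empty at points where the function is not finite.\<close>

definition subdifferential :: "('a::euclidean_space \<Rightarrow> ereal) \<Rightarrow> 'a \<Rightarrow> 'a set" where
  "subdifferential h x =
     {s. \<bar>h x\<bar> \<noteq> \<infinity> \<and> (\<forall>y. h y \<ge> h x + ereal (s \<bullet> (y - x)))}"

text \<open>The composite problem: minimise \<open>f + \<psi>\<close> over the domain of \<open>\<psi>\<close>.\<close>

definition composite_problem :: "(real^'n \<Rightarrow> ereal) \<Rightarrow> (real^'n \<Rightarrow> ereal) \<Rightarrow> bool" where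
  "composite_problem f \<psi> \<longleftrightarrow>
     closed_convex_fun \<psi> \<and> edom \<psi> \<noteq> {} \<and>
     closed_convex_fun f \<and>
     (\<exists>U. open U \<and> edom \<psi> \<subseteq> U \<and> (\<forall>x\<in>U. \<bar>f x\<bar> \<noteq> \<infinity> \<and> subdifferential f x \<noteq> {}))"

definition objective :: "('a \<Rightarrow> ereal) \<Rightarrow> ('a \<Rightarrow> ereal) \<Rightarrow> 'a \<Rightarrow> ereal" where
  "objective f \<psi> x = f x + \<psi> x"

definition opt_value :: "('a \<Rightarrow> ereal) \<Rightarrow> ('a \<Rightarrow> ereal) \<Rightarrow> ereal" where
  "opt_value f \<psi> = (INF x\<in>edom \<psi>. objective f \<psi> x)"

text \<open>Being \<^typ>\<open>ennreal\<close>-valued, the supremum is \<open>0\<close> (not \<open>-\<infinity>\<close>) when the domain of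
  \<open>\<psi>\<close> is a single point.\<close>

definition hoelder_const ::
  "real^'n^'n \<Rightarrow> (real^'n \<Rightarrow> ereal) \<Rightarrow> (real^'n \<Rightarrow> ereal) \<Rightarrow> real \<Rightarrow> ennreal" where
  "hoelder_const B f \<psi> \<nu> =
     Sup {ennreal (dnorm B (s - t) / pnorm B (x - y) powr \<nu>) | x y s t.
            x \<in> edom \<psi> \<and> y \<in> edom \<psi> \<and> x \<noteq> y \<and>
            s \<in> subdifferential f x \<and> t \<in> subdifferential f y}"

text \<open>Positive powers on \<open>[0, \<infinity>]\<close>; only used with \<open>a > 0\<close>.\<close>

definition ennreal_powr :: "ennreal \<Rightarrow> real \<Rightarrow> ennreal" where
  "ennreal_powr t a = (if t = \<infinity> then \<infinity> else ennreal (enn2real t powr a))"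


section \<open>Stochastic gradient oracle\<close>

text \<open>An oracle \<open>(g, \<xi>)\<close> is given by the law \<open>P\<close> of \<open>\<xi>\<close> (so \<open>space P\<close> is the range of \<open>\<xi>\<close>)
  and the map \<open>g\<close>. Joint measurability of \<open>g\<close> is the implicit condition under which querying
  the oracle at a random point yields a random vector.\<close>

definition oracle_mean :: "'z measure \<Rightarrow> (real^'n \<Rightarrow> 'z \<Rightarrow> real^'n) \<Rightarrow> real^'n \<Rightarrow> real^'n" where
  "oracle_mean P g x = (\<integral>z. g x z \<partial>P)"

definition unbiased_oracle ::
  "(real^'n \<Rightarrow> ereal) \<Rightarrow> (real^'n \<Rightarrow> ereal) \<Rightarrow> 'z measure \<Rightarrow> (real^'n \<Rightarrow> 'z \<Rightarrow> real^'n) \<Rightarrow> bool" where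
  "unbiased_oracle f \<psi> P g \<longleftrightarrow>
     prob_space P \<and>
     (\<lambda>(x, z). g x z) \<in> borel_measurable (restrict_space borel (edom \<psi>) \<Otimes>\<^sub>M P) \<and>
     (\<forall>x\<in>edom \<psi>. integrable P (g x) \<and> oracle_mean P g x \<in> subdifferential f x)"

definition oracle_variance ::
  "real^'n^'n \<Rightarrow> (real^'n \<Rightarrow> ereal) \<Rightarrow> 'z measure \<Rightarrow> (real^'n \<Rightarrow> 'z \<Rightarrow> real^'n) \<Rightarrow> ennreal" where
  "oracle_variance B \<psi> P g =
     (SUP x\<in>edom \<psi>. \<integral>\<^sup>+z. ennreal ((dnorm B (g x z - oracle_mean P g x))\<^sup>2) \<partial>P)"

definition oracle_sigma ::
  "real^'n^'n \<Rightarrow> (real^'n \<Rightarrow> ereal) \<Rightarrow> 'z measure \<Rightarrow> (real^'n \<Rightarrow> 'z \<Rightarrow> real^'n) \<Rightarrow> real" where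
  "oracle_sigma B \<psi> P g = sqrt (enn2real (oracle_variance B \<psi> P g))"

text \<open>\<open>past_events M P Z X k\<close> is the \<open>\<sigma>\<close>-algebra of everything generated before the oracle is
  queried at \<open>X k\<close>: the noise \<open>Z 0, \<dots>, Z (k - 1)\<close> of the earlier queries and the points
  \<open>X 0, \<dots>, X k\<close>. The points are listed separately because the minimiser selected in a step need
  not be a measurable function of the earlier noise.\<close>

definition past_events ::
  "'w measure \<Rightarrow> 'z measure \<Rightarrow> (nat \<Rightarrow> 'w \<Rightarrow> 'z) \<Rightarrow> (nat \<Rightarrow> 'w \<Rightarrow> real^'n) \<Rightarrow> nat \<Rightarrow> 'w set set"
where
  "past_events M P Z X k = sigma_sets (space M)
     ({Z i -` A \<inter> space M | i A. i < k \<and> A \<in> sets P} \<union>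
      {X i -` A \<inter> space M | i A. i \<le> k \<and> A \<in> sets borel})"

definition fresh_samples ::
  "'w measure \<Rightarrow> 'z measure \<Rightarrow> (nat \<Rightarrow> 'w \<Rightarrow> 'z) \<Rightarrow> (nat \<Rightarrow> 'w \<Rightarrow> real^'n) \<Rightarrow> bool" where
  "fresh_samples M P Z X \<longleftrightarrow>
     (\<forall>k. X k \<in> borel_measurable M \<and>
          Z k \<in> measurable M P \<and> distr M P (Z k) = P \<and>
          prob_space.indep_set M
            (sigma_sets (space M) {Z k -` A \<inter> space M | A. A \<in> sets P})
            (past_events M P Z X k))"


section \<open>Universal Stochastic Gradient Method\<close>

primrec usgm_H ::
  "real^'n^'n \<Rightarrow> real \<Rightarrow> (nat \<Rightarrow> real^'n) \<Rightarrow> (nat \<Rightarrow> real^'n) \<Rightarrow> nat \<Rightarrow> real" where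
  "usgm_H B D x s 0 = 0"
| "usgm_H B D x s (Suc k) =
     (let r = pnorm B (x (Suc k) - x k);
          \<beta> = (s (Suc k) - s k) \<bullet> (x (Suc k) - x k);
          H = usgm_H B D x s k
      in H + max 0 (\<beta> - 1/2 * H * r\<^sup>2) / (D\<^sup>2 + 1/2 * r\<^sup>2))"

text \<open>A single trajectory: \<open>x\<close> are the iterates and \<open>s\<close> the stochastic gradients returned by the
  oracle at them.\<close>

definition usgm_trajectory ::
  "real^'n^'n \<Rightarrow> (real^'n \<Rightarrow> ereal) \<Rightarrow> real \<Rightarrow> real^'n \<Rightarrow>
   (nat \<Rightarrow> real^'n) \<Rightarrow> (nat \<Rightarrow> real^'n) \<Rightarrow> bool" where
  "usgm_trajectory B \<psi> D x0 x s \<longleftrightarrow>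
     x 0 = x0 \<and>
     (\<forall>k. is_arg_min
            (\<lambda>y. ereal (s k \<bullet> y) + \<psi> y + ereal (usgm_H B D x s k / 2 * (pnorm B (y - x k))\<^sup>2))
            (\<lambda>y. y \<in> edom \<psi>) (x (Suc k)))"

definition usgm_average :: "(nat \<Rightarrow> 'w \<Rightarrow> real^'n) \<Rightarrow> nat \<Rightarrow> 'w \<Rightarrow> real^'n" where
  "usgm_average X k \<omega> = (1 / real k) *\<^sub>R (\<Sum>i=1..k. X i \<omega>)"

text \<open>Calls made by the initialisation (one) and the first \<open>k\<close> iterations (one each).\<close>

definition usgm_calls :: "nat \<Rightarrow> nat" where
  "usgm_calls k = k + 1"

end

theory Submission
  imports Defs
begin

text \<open>
  Convexity of \<open>f\<close> and the optimality of \<open>x (k + 1)\<close> bound the gap \<open>F (x (k + 1)) - F*\<close> by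
  \<open>\<beta> - H k * r\<^sup>2 / 2 + H k / 2 * (\<parallel>x k - x*\<parallel>\<^sup>2 - \<parallel>x (k + 1) - x*\<parallel>\<^sup>2)\<close> plus inner products of
  the oracle noise with vectors known before the query, which vanish in expectation. By the choice of
  \<open>H (k + 1)\<close> the remaining terms telescope to at most \<open>2 * D\<^sup>2 * H k\<close>.

  On every trajectory \<open>H k \<le> 4 * L * D\<^bsup>\<nu> - 1\<^esup> * k\<^bsup>(1 - \<nu>) / 2\<^esup> + sqrt (\<Sum>i<k. e\<^sub>i\<^sup>2) / D\<close> holds for
  every \<open>\<nu>\<close>, where \<open>e\<^sub>i\<close> is the dual norm of the difference of two consecutive noise vectors. Since
  \<open>E e\<^sub>i\<^sup>2 \<le> 4 * \<sigma>\<^sup>2\<close>, Jensen's inequality gives the rate.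
\<close>

section \<open>Primal and dual norms\<close>

text \<open>The obstacle is that \<open>x (k + 1)\<close> is computed from the sample at
  \<open>x k\<close>, so the noise there is correlated with \<open>x (k + 1) - x k\<close> and their
  product need not vanish in expectation. Convexity is therefore used twice, at \<open>x k\<close>
  towards \<open>x*\<close> and at \<open>x (k + 1)\<close> towards \<open>x k\<close>: the
  correlated product then occurs only inside \<open>\<beta>\<close>, which the coefficients are
  built to pay for. The update of \<open>H\<close> is the closed form of the implicit equation
  \<open>D\<^sup>2 * (H (k + 1) - H k) = max 0 (\<beta> - H (k + 1) * r\<^sup>2 / 2)\<close>. Having
  the new coefficient on the right allows \<open>H\<close> to be compared, on each trajectory, with
  any sequence whose own increments dominate the same expression. Expectations are taken only of
  this majorant, and the exponent \<nu> stays a free parameter until the infimum is formed at the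
  end. In the rate, 8 is the 2 of the telescoped sum times the 4 in the bound on \<open>H\<close>,
  and the 4 before \<sigma> is the same 2 times \<open>sqrt 4\<close>.\<close>

lemma spd_inner_commute:
  assumes "spd_matrix B"
  shows "(B *v x) \<bullet> y = x \<bullet> (B *v y)"
proof -
  have "transpose B = B"
    using assms by (simp add: spd_matrix_def)
  then have "B *v x = x v* B"
    using transpose_matrix_vector[of B x] by simp
  then show ?thesis
    by (simp add: dot_lmul_matrix)
qed

lemma spd_inner_nonneg: "spd_matrix B \<Longrightarrow> 0 \<le> (B *v x) \<bullet> x"
  unfolding spd_matrix_def by (cases "x = 0") (auto simp: less_imp_le)

lemma pnorm_nonneg: "spd_matrix B \<Longrightarrow> 0 \<le> pnorm B x"
  by (simp add: pnorm_def spd_inner_nonneg)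

lemma pnorm_power2: "spd_matrix B \<Longrightarrow> (pnorm B x)\<^sup>2 = (B *v x) \<bullet> x"
  by (simp add: pnorm_def spd_inner_nonneg)

lemma pnorm_pos: "spd_matrix B \<Longrightarrow> x \<noteq> 0 \<Longrightarrow> 0 < pnorm B x"
  by (simp add: pnorm_def spd_matrix_def)

lemma pnorm_0 [simp]: "pnorm B 0 = 0"
  by (simp add: pnorm_def)

lemma pnorm_minus_commute: "pnorm B (x - y) = pnorm B (y - x)"
proof -
  have "B *v (x - y) = - (B *v (y - x))"
    by (simp add: matrix_vector_mult_diff_distrib)
  then have "(B *v (x - y)) \<bullet> (x - y) = (B *v (y - x)) \<bullet> (y - x)"
    by (simp add: inner_diff_right)
  then show ?thesis
    by (simp add: pnorm_def)
qed

lemma pnorm_power2_add_scaleR: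
  assumes "spd_matrix B"
  shows "(pnorm B (x + t *\<^sub>R y))\<^sup>2
    = (pnorm B x)\<^sup>2 + 2 * t * ((B *v x) \<bullet> y) + t\<^sup>2 * (pnorm B y)\<^sup>2"
proof -
  have "(B *v y) \<bullet> x = (B *v x) \<bullet> y"
    using spd_inner_commute[OF assms, of y x] by (simp add: inner_commute)
  then show ?thesis
    unfolding pnorm_power2[OF assms]
    by (simp add: matrix_vector_right_distrib matrix_vector_mult_scaleR
        inner_add_left inner_add_right power2_eq_square algebra_simps)
qed

lemma pnorm_Cauchy_Schwarz:
  assumes "spd_matrix B"
  shows "(B *v x) \<bullet> y \<le> pnorm B x * pnorm B y"
proof (cases "y = 0")
  case False
  define c where "c = (B *v x) \<bullet> y"
  have y: "0 < (pnorm B y)\<^sup>2"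
    using pnorm_pos[OF assms False] by simp
  \<comment> \<open>The minimiser of the quadratic
    \<open>t \<mapsto> (pnorm B (x + t *\<^sub>R y))\<^sup>2\<close>.\<close>
  define t where "t = - c / (pnorm B y)\<^sup>2"
  have "0 \<le> (pnorm B (x + t *\<^sub>R y))\<^sup>2"
    by simp
  also have "\<dots> = (pnorm B x)\<^sup>2 + 2 * t * c + t\<^sup>2 * (pnorm B y)\<^sup>2"
    by (simp add: pnorm_power2_add_scaleR[OF assms] c_def)
  also have "\<dots> = (pnorm B x)\<^sup>2 - c\<^sup>2 / (pnorm B y)\<^sup>2"
  proof -
    have "t * (pnorm B y)\<^sup>2 = - c"
      using y by (simp add: t_def)
    then have "2 * t * c + t\<^sup>2 * (pnorm B y)\<^sup>2 = t * c"
      by (simp add: power2_eq_square[of t] mult.assoc)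
    also have "\<dots> = - (c\<^sup>2 / (pnorm B y)\<^sup>2)"
      by (simp add: t_def power2_eq_square[of c])
    finally show ?thesis
      by simp
  qed
  finally have "c\<^sup>2 / (pnorm B y)\<^sup>2 \<le> (pnorm B x)\<^sup>2"
    by simp
  then have "c\<^sup>2 \<le> (pnorm B x * pnorm B y)\<^sup>2"
    unfolding power_mult_distrib by (simp only: pos_divide_le_eq[OF y])
  then show ?thesis
    unfolding c_def by (rule power2_le_imp_le) (simp add: pnorm_nonneg[OF assms])
qed simp

lemma spd_inj:
  assumes "spd_matrix B"
  shows "inj ((*v) B)"
proof (rule injI)
  fix x y
  assume "B *v x = B *v y"
  then have "(B *v (x - y)) \<bullet> (x - y) = 0"
    by (simp add: matrix_vector_mult_diff_distrib)
  then show "x = y"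
    using assms unfolding spd_matrix_def by (metis less_irrefl right_minus_eq)
qed

lemma spd_inverse:
  fixes B :: "real^'n^'n"
  assumes "spd_matrix B"
  shows "B *v (matrix_inv B *v x) = x"
proof -
  have "\<exists>A. A ** B = mat 1"
    using spd_inj[OF assms] by (simp add: matrix_left_invertible_injective)
  then have "\<exists>A. B ** A = mat 1 \<and> A ** B = mat 1"
    by (metis matrix_left_right_inverse)
  then have "B ** matrix_inv B = mat 1"
    unfolding matrix_inv_def by (rule someI2_ex) simp
  then show ?thesis
    by (simp add: matrix_vector_mul_assoc)
qed

text \<open>Replaces a dual vector by its Riesz representative, so that Cauchy-Schwarz and the
  parallelogram law carry over to the dual norm.\<close>

lemma dnorm_eq_pnorm:
  assumes "spd_matrix B"
  shows "dnorm B s = pnorm B (matrix_inv B *v s)"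
  by (simp add: dnorm_def pnorm_def spd_inverse[OF assms])

lemma dnorm_nonneg: "spd_matrix B \<Longrightarrow> 0 \<le> dnorm B s"
  by (simp add: dnorm_eq_pnorm pnorm_nonneg)

lemma inner_le_dnorm_pnorm:
  assumes "spd_matrix B"
  shows "s \<bullet> x \<le> dnorm B s * pnorm B x"
  using pnorm_Cauchy_Schwarz[OF assms, of "matrix_inv B *v s" x]
  by (simp add: dnorm_eq_pnorm[OF assms] spd_inverse[OF assms])

lemma abs_inner_le_dnorm_pnorm:
  assumes "spd_matrix B"
  shows "\<bar>s \<bullet> x\<bar> \<le> dnorm B s * pnorm B x"
  using inner_le_dnorm_pnorm[OF assms, of s x] inner_le_dnorm_pnorm[OF assms, of s "- x"]
    pnorm_minus_commute[of B 0 x]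
  by simp

text \<open>The parallelogram law with the square of the sum dropped.\<close>

lemma dnorm_diff_power2_le:
  assumes "spd_matrix B"
  shows "(dnorm B (s - t))\<^sup>2 \<le> 2 * (dnorm B s)\<^sup>2 + 2 * (dnorm B t)\<^sup>2"
proof -
  let ?u = "matrix_inv B *v s" and ?v = "matrix_inv B *v t"
  have "(pnorm B (?u - ?v))\<^sup>2 + (pnorm B (?u + ?v))\<^sup>2 = 2 * (pnorm B ?u)\<^sup>2 + 2 * (pnorm B ?v)\<^sup>2"
    using pnorm_power2_add_scaleR[OF assms, of ?u 1 ?v]
      pnorm_power2_add_scaleR[OF assms, of ?u "-1" ?v] by simp
  then show ?thesis
    using zero_le_power2[of "pnorm B (?u + ?v)"]
    unfolding dnorm_eq_pnorm[OF assms] matrix_vector_mult_diff_distrib by linarith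
qed

lemma continuous_on_dnorm: "continuous_on UNIV (dnorm B)"
  unfolding dnorm_def
  by (intro continuous_intros linear_continuous_on linear_linear[THEN iffD1]
      matrix_vector_mul_linear)

lemma borel_measurable_dnorm [measurable (raw)]:
  "h \<in> borel_measurable M \<Longrightarrow> (\<lambda>w. dnorm B (h w)) \<in> borel_measurable M"
  using borel_measurable_continuous_onI[OF continuous_on_dnorm] by (rule measurable_compose_rev)

text \<open>Transfers the diameter bound to the Euclidean norm, where compactness is available for
  the existence of a minimiser. Duality gives
  \<open>(norm u)\<^sup>2 \<le> dnorm B u * pnorm B u\<close>, and \<open>dnorm B u\<close> is at
  most a constant times \<open>norm u\<close>, hence
  \<open>(norm u)\<^sup>2 \<le> \<bar>K\<bar> * D\<^sup>2\<close>. The additional 1 in the bound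
  avoids a square root, as \<open>t \<le> t\<^sup>2 + 1\<close>.\<close>

lemma bounded_of_pnorm_diam:
  fixes B :: "real^'n^'n"
  assumes B: "spd_matrix B" and diam: "\<forall>x\<in>C. \<forall>y\<in>C. pnorm B (x - y) \<le> D"
  shows "bounded C"
proof (cases "C = {}")
  case False
  then obtain a where a: "a \<in> C"
    by blast
  obtain K where K: "\<And>x. norm (matrix_inv B *v x) \<le> norm x * K"
    using bounded_linear.bounded[OF linear_linear[THEN iffD2, OF matrix_vector_mul_linear]]
    by blast
  have "norm (x - a) \<le> \<bar>K\<bar> * D\<^sup>2 + 1" if x: "x \<in> C" for x
  proof (rule ccontr)
    assume *: "\<not> ?thesis"
    let ?u = "x - a"
    have "0 \<le> \<bar>K\<bar> * D\<^sup>2"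
      by simp
    then have n: "norm ?u > 0"
      using * by linarith
    have p: "pnorm B ?u \<le> D" "0 \<le> pnorm B ?u"
      using diam x a by (auto intro: pnorm_nonneg B)
    have d: "(dnorm B ?u)\<^sup>2 \<le> \<bar>K\<bar> * (norm ?u)\<^sup>2"
    proof -
      have "(dnorm B ?u)\<^sup>2 = ?u \<bullet> (matrix_inv B *v ?u)"
        using dnorm_nonneg[OF B, of ?u] by (simp add: dnorm_def)
      also have "\<dots> \<le> norm ?u * norm (matrix_inv B *v ?u)"
        by (rule norm_cauchy_schwarz)
      also have "\<dots> \<le> norm ?u * (norm ?u * \<bar>K\<bar>)"
        by (intro mult_left_mono order.trans[OF K]) auto
      finally show ?thesis by (simp add: power2_eq_square ac_simps)
    qed
    have "(norm ?u)\<^sup>2 \<le> dnorm B ?u * pnorm B ?u"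
      using inner_le_dnorm_pnorm[OF B, of ?u ?u] by (simp add: power2_norm_eq_inner)
    then have "((norm ?u)\<^sup>2)\<^sup>2 \<le> (dnorm B ?u * pnorm B ?u)\<^sup>2"
      by (intro power_mono) auto
    also have "\<dots> \<le> (\<bar>K\<bar> * (norm ?u)\<^sup>2) * D\<^sup>2"
      unfolding power_mult_distrib using p d by (intro mult_mono power_mono) auto
    finally have "(norm ?u)\<^sup>2 * (norm ?u)\<^sup>2 \<le> (norm ?u)\<^sup>2 * (\<bar>K\<bar> * D\<^sup>2)"
      by (simp only: power2_eq_square ac_simps)
    moreover have "(norm ?u)\<^sup>2 > 0"
      using n by simp
    ultimately have "(norm ?u)\<^sup>2 \<le> \<bar>K\<bar> * D\<^sup>2"
      by (simp only: mult_le_cancel_left_pos)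
    moreover have "norm ?u \<le> (norm ?u)\<^sup>2 + 1"
      using zero_le_power2[of "norm ?u - 1"] norm_ge_zero[of ?u]
      unfolding power2_diff power_one mult_1_right by linarith
    ultimately show False using * by simp
  qed
  then show ?thesis
    unfolding bounded_def dist_norm by (metis norm_minus_commute)
qed simp

section \<open>Optimality condition of a regularised step\<close>

lemma nonneg_slope_of_quadratic:
  fixes a c :: real
  assumes "\<And>t. 0 < t \<Longrightarrow> t \<le> 1 \<Longrightarrow> 0 \<le> t * a + t\<^sup>2 * c"
  shows "0 \<le> a"
proof (rule ccontr)
  assume a: "\<not> 0 \<le> a"
  \<comment> \<open>So small that \<open>t * \<bar>c\<bar> \<le> - a / 2\<close>; the slope
    \<open>a\<close> then dominates and the quadratic is negative.\<close>
  define t where "t = min 1 (- a / (2 * (\<bar>c\<bar> + 1)))"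
  have t: "0 < t" "t \<le> 1"
    using a by (auto simp: t_def intro!: divide_neg_pos)
  have "t \<le> - a / (2 * (\<bar>c\<bar> + 1))"
    by (simp add: t_def)
  then have t': "t * (2 * (\<bar>c\<bar> + 1)) \<le> - a"
    by (subst (asm) pos_le_divide_eq) auto
  have "0 \<le> t * (a + t * c)"
    using assms[OF t(1,2)] by (simp add: power2_eq_square algebra_simps)
  then have "0 \<le> a + t * c"
    using t(1) by (simp add: zero_le_mult_iff)
  moreover have "t * c \<le> t * (\<bar>c\<bar> + 1)"
    using t(1) by (intro mult_left_mono) auto
  ultimately show False
    using t' a by (simp add: algebra_simps)
qed

text \<open>Comparing \<open>xp\<close> with the points of the segment towards \<open>y\<close>
  gives the first-order condition at \<open>xp\<close>; expanding the square around
  \<open>xp\<close> exactly then produces the additional term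
  \<open>H / 2 * (pnorm B (y - xp))\<^sup>2\<close>. No differentiability of \<open>\<psi>\<close>
  is involved, and \<open>H = 0\<close>, the value in the first iteration, is covered.\<close>

lemma proximal_step:
  fixes B :: "real^'n^'n" and \<psi> :: "real^'n \<Rightarrow> real"
  assumes B: "spd_matrix B" and conv: "convex_on C \<psi>" and xp: "xp \<in> C" and y: "y \<in> C"
    and min: "\<And>z. z \<in> C \<Longrightarrow> s \<bullet> xp + \<psi> xp + H / 2 * (pnorm B (xp - x))\<^sup>2
                \<le> s \<bullet> z + \<psi> z + H / 2 * (pnorm B (z - x))\<^sup>2"
  shows "s \<bullet> xp + \<psi> xp + H / 2 * (pnorm B (xp - x))\<^sup>2 + H / 2 * (pnorm B (y - xp))\<^sup>2
         \<le> s \<bullet> y + \<psi> y + H / 2 * (pnorm B (y - x))\<^sup>2"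
proof -
  define d where "d = y - xp"
  define b where "b = (B *v (xp - x)) \<bullet> d"
  have "0 \<le> s \<bullet> d + \<psi> y - \<psi> xp + H * b"
  proof (rule nonneg_slope_of_quadratic)
    fix t :: real
    assume t: "0 < t" "t \<le> 1"
    define z where "z = xp + t *\<^sub>R d"
    have z: "z = (1 - t) *\<^sub>R xp + t *\<^sub>R y"
      by (simp add: z_def d_def algebra_simps)
    have zC: "z \<in> C"
      unfolding z using convex_on_imp_convex[OF conv] xp y t by (intro convexD) auto
    have "\<psi> z \<le> (1 - t) * \<psi> xp + t * \<psi> y"
      unfolding z using convex_onD[OF conv, of t xp y] xp y t by simp
    moreover have "z - x = (xp - x) + t *\<^sub>R d"
      by (simp add: z_def)
    from this have "(pnorm B (z - x))\<^sup>2 = (pnorm B (xp - x))\<^sup>2 + 2 * t * b + t\<^sup>2 * (pnorm B d)\<^sup>2"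
      unfolding b_def by (simp only: pnorm_power2_add_scaleR[OF B])
    moreover have "s \<bullet> z = s \<bullet> xp + t * (s \<bullet> d)"
      by (simp add: z_def inner_add_right)
    ultimately show "0 \<le> t * (s \<bullet> d + \<psi> y - \<psi> xp + H * b) + t\<^sup>2 * (H / 2 * (pnorm B d)\<^sup>2)"
      using min[OF zC] by (simp add: algebra_simps)
  qed
  moreover have "(pnorm B (y - x))\<^sup>2 = (pnorm B (xp - x))\<^sup>2 + 2 * b + (pnorm B d)\<^sup>2"
    using pnorm_power2_add_scaleR[OF B, of "xp - x" 1 d] by (simp add: b_def d_def)
  ultimately show ?thesis
    by (simp add: d_def inner_diff_right algebra_simps)
qed

section \<open>Growth of the step-size coefficients and regret\<close>

text \<open>Concavity of the power: its tangent at \<open>Suc k\<close> lies above its value at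
  \<open>k\<close>. Young's inequality supplies it for \<open>k > 0\<close>. At \<open>k = 0\<close>
  the claim is \<open>p \<le> 1\<close>, since \<open>0 powr p = 0\<close> even for
  \<open>p = 0\<close>.\<close>

lemma powr_tangent_le:
  fixes p :: real
  assumes "0 \<le> p" "p \<le> 1"
  shows "real k powr p + p * real (Suc k) powr (p - 1) \<le> real (Suc k) powr p"
proof (cases "k = 0")
  case False
  define n where "n = real (Suc k)"
  have n: "n > 0" and k: "real k = n - 1"
    by (auto simp: n_def)
  have "real k powr p * n powr (1 - p) \<le> p * real k + (1 - p) * n"
    using assms False n by (intro Youngs_inequality_0) auto
  also have "\<dots> = n - p"
    by (simp add: k algebra_simps)
  finally have "real k powr p * n powr (1 - p) * n powr (p - 1) \<le> (n - p) * n powr (p - 1)"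
    by (rule mult_right_mono) simp
  moreover have "n powr (1 - p) * n powr (p - 1) = 1"
    using n by (simp flip: powr_add)
  moreover have "n * n powr (p - 1) = n powr p"
    using n by (simp add: powr_diff)
  ultimately show ?thesis
    by (simp add: n_def mult.assoc left_diff_distrib)
qed (use assms in auto)

text \<open>Weighted AM-GM for \<open>n * u\<^sup>2\<close> and 1 with weights \<open>1 - p\<close>
  and \<open>p\<close>, rescaled by \<open>n powr (p - 1)\<close>. For
  \<open>2 - 2 * p = 1 + \<nu>\<close> it trades the Hoelder power for a quadratic, which a
  coefficient of order \<open>n powr p\<close> absorbs, and a remainder no larger than one increment
  of \<open>n powr p\<close>.\<close>

lemma hoelder_young:
  fixes p u n :: real
  assumes p: "0 \<le> p" "p < 1" and u: "0 \<le> u" and n: "0 < n"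
  shows "u powr (2 - 2 * p) \<le> (1 - p) * n powr p * u\<^sup>2 + p * n powr (p - 1)"
proof (cases "u = 0")
  case False
  with u have u: "u > 0"
    by simp
  have "(n * u\<^sup>2) powr (1 - p) * 1 powr p \<le> (1 - p) * (n * u\<^sup>2) + p * 1"
    using p u n by (intro Youngs_inequality_0) auto
  also have "(n * u\<^sup>2) powr (1 - p) = n powr (1 - p) * u powr (2 - 2 * p)"
    using u n by (simp add: powr_mult powr_powr right_diff_distrib flip: powr_numeral)
  finally have "n powr (p - 1) * (n powr (1 - p) * u powr (2 - 2 * p))
      \<le> n powr (p - 1) * ((1 - p) * (n * u\<^sup>2) + p)"
    by (intro mult_left_mono) auto
  moreover have "n powr (p - 1) * n powr (1 - p) = 1"
    using n by (simp flip: powr_add)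
  moreover have "n powr (p - 1) * n = n powr p"
    using n by (simp add: powr_diff)
  moreover have "n powr (p - 1) * ((1 - p) * (n * u\<^sup>2) + p)
      = (1 - p) * (n powr (p - 1) * n) * u\<^sup>2 + p * n powr (p - 1)"
    by (simp add: algebra_simps)
  ultimately show ?thesis
    by (simp add: mult.assoc[symmetric])
qed (use p in auto)

text \<open>Measuring \<open>r\<close> in units of \<open>D\<close> leaves the common factor
  \<open>Q = L * D powr (1 + \<nu>)\<close> and a scalar inequality with
  \<open>p = (1 - \<nu>) / 2\<close>. The factor 4 in \<open>A\<close> is the one that matches the 8
  of the rate; Young's inequality would already allow 2.\<close>

lemma hoelder_increment:
  fixes L D r \<nu> :: real
  defines "A \<equiv> \<lambda>k. 4 * L * D powr (\<nu> - 1) * real k powr ((1 - \<nu>) / 2)"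
  assumes D: "D > 0" and L: "L \<ge> 0" and \<nu>: "0 \<le> \<nu>" "\<nu> \<le> 1" and r: "0 \<le> r"
  shows "L * r powr (1 + \<nu>) - A (Suc k) * r\<^sup>2 / 2 \<le> D\<^sup>2 * (A (Suc k) - A k)"
proof -
  define p where "p = (1 - \<nu>) / 2"
  define n where "n = real (Suc k)"
  define u where "u = r / D"
  define Q where "Q = L * (D\<^sup>2 * D powr (\<nu> - 1))"
  have Q: "Q \<ge> 0"
    using L by (simp add: Q_def)
  have p: "0 \<le> p" "p \<le> 1 / 2" "1 + \<nu> = 2 - 2 * p"
    using \<nu> by (auto simp: p_def field_simps)
  have ru: "r = D * u" and u: "0 \<le> u"
    using D r by (auto simp: u_def)
  have "D powr (1 + \<nu>) = D powr (2 + (\<nu> - 1))"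
    by simp
  also have "\<dots> = D\<^sup>2 * D powr (\<nu> - 1)"
    unfolding powr_add using D by (simp add: powr_numeral)
  finally have "L * r powr (1 + \<nu>) = Q * u powr (2 - 2 * p)"
    using D u by (simp add: ru powr_mult Q_def p(3)[symmetric])
  moreover have "A (Suc k) * r\<^sup>2 / 2 = Q * (2 * n powr p * u\<^sup>2)"
    by (simp add: A_def Q_def ru n_def p_def power_mult_distrib)
  moreover have "D\<^sup>2 * (A (Suc k) - A k) = Q * (4 * (n powr p - real k powr p))"
    by (simp add: A_def Q_def n_def p_def algebra_simps)
  moreover have "u powr (2 - 2 * p) - 2 * n powr p * u\<^sup>2 \<le> 4 * (n powr p - real k powr p)"
  proof -
    have "u powr (2 - 2 * p) \<le> (1 - p) * n powr p * u\<^sup>2 + p * n powr (p - 1)"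
      using p u by (intro hoelder_young) (auto simp: n_def)
    moreover have "(1 - p) * (n powr p * u\<^sup>2) \<le> 2 * (n powr p * u\<^sup>2)"
      using p by (intro mult_right_mono) auto
    moreover have "p * n powr (p - 1) \<le> n powr p - real k powr p"
      using powr_tangent_le[of p k] p by (simp add: n_def)
    moreover have "0 \<le> p * n powr (p - 1)"
      using p by simp
    ultimately show ?thesis
      by (simp add: mult.assoc)
  qed
  ultimately show ?thesis
    using mult_left_mono[OF _ Q] by (metis right_diff_distrib)
qed

text \<open>The potential argument of AdaGrad. With \<open>a = sqrt (q + e\<^sup>2)\<close> and
  \<open>b = sqrt q\<close>, maximising the left side over \<open>r\<close> gives
  \<open>D * e\<^sup>2 / (2 * a)\<close>; since \<open>e\<^sup>2 = (a - b) * (a + b)\<close> and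
  \<open>a + b \<le> 2 * a\<close>, this is at most \<open>D * (a - b)\<close>. The case
  \<open>e = 0\<close> is separate because \<open>a\<close> may then vanish.\<close>

lemma noise_increment:
  fixes D e q r :: real
  assumes D: "D > 0" and q: "q \<ge> 0"
  shows "e * r - sqrt (q + e\<^sup>2) / D * r\<^sup>2 / 2 \<le> D\<^sup>2 * (sqrt (q + e\<^sup>2) / D - sqrt q / D)"
proof (cases "e = 0")
  case True
  then show ?thesis
    using D q by simp
next
  case False
  define a where "a = sqrt (q + e\<^sup>2)"
  define b where "b = sqrt q"
  have a: "a > 0"
    using q False by (simp add: a_def add_nonneg_pos)
  have ba: "b \<le> a" "0 \<le> b"
    using q by (simp_all add: a_def b_def)
  have e: "e\<^sup>2 = (a - b) * (a + b)"
  proof -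
    have "a\<^sup>2 = q + e\<^sup>2" "b\<^sup>2 = q"
      using q by (simp_all add: a_def b_def)
    moreover have "(a - b) * (a + b) = a\<^sup>2 - b\<^sup>2"
      by (simp add: power2_eq_square algebra_simps)
    ultimately show ?thesis
      by simp
  qed
  have "2 * a * (e * r - a / D * r\<^sup>2 / 2) \<le> D * e\<^sup>2"
  proof -
    have "0 \<le> D * (e - a * (r / D))\<^sup>2"
      using D by simp
    also have "\<dots> = D * e\<^sup>2 - 2 * a * (e * r - a / D * r\<^sup>2 / 2)"
      using D by (simp add: power2_eq_square field_simps)
    finally show ?thesis
      by simp
  qed
  also have "\<dots> \<le> D * ((a - b) * (2 * a))"
    unfolding e using D ba by (intro mult_left_mono) auto
  also have "\<dots> = 2 * a * (D * (a - b))"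
    by simp
  finally have "e * r - a / D * r\<^sup>2 / 2 \<le> D * (a - b)"
    using a by (simp only: mult_le_cancel_left_pos)
  also have "\<dots> = D\<^sup>2 * (a / D - b / D)"
    using D by (simp add: power2_eq_square field_simps)
  finally show ?thesis
    by (simp add: a_def b_def)
qed

lemma usgm_H_le_Suc:
  "usgm_H B D x s k \<le> usgm_H B D x s (Suc k)"
  by (simp add: Let_def)

lemma usgm_H_nonneg: "0 \<le> usgm_H B D x s k"
proof (induction k)
  case (Suc k)
  then show ?case
    using usgm_H_le_Suc order.trans by blast
qed simp

lemma usgm_H_Suc_diff:
  fixes B :: "real^'n^'n"
  assumes "D > 0"
  shows "(usgm_H B D x s (Suc k) - usgm_H B D x s k) * (D\<^sup>2 + (pnorm B (x (Suc k) - x k))\<^sup>2 / 2)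
    = max 0 ((s (Suc k) - s k) \<bullet> (x (Suc k) - x k)
        - usgm_H B D x s k * (pnorm B (x (Suc k) - x k))\<^sup>2 / 2)"
proof -
  have "D\<^sup>2 + (pnorm B (x (Suc k) - x k))\<^sup>2 / 2 > 0"
    using assms by (intro add_pos_nonneg) auto
  then show ?thesis
    by (simp add: Let_def)
qed

text \<open>The two summands of the bound absorb the smooth and the noisy part of the curvature separately:
  if \<open>H\<close> grows above the bound, then
  \<open>D\<^sup>2 * (H (Suc k) - H k) = \<beta> - H (Suc k) * r\<^sup>2 / 2\<close> is at most the increment of the bound.\<close>

lemma usgm_H_bound:
  fixes B :: "real^'n^'n"
  assumes B: "spd_matrix B" and D: "D > 0" and L: "L \<ge> 0" and \<nu>: "0 \<le> \<nu>" "\<nu> \<le> 1"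
    and curv: "\<And>i. (s (Suc i) - s i) \<bullet> (x (Suc i) - x i)
      \<le> L * pnorm B (x (Suc i) - x i) powr (1 + \<nu>) + e i * pnorm B (x (Suc i) - x i)"
  shows "usgm_H B D x s k
    \<le> 4 * L * D powr (\<nu> - 1) * real k powr ((1 - \<nu>) / 2) + sqrt (\<Sum>i<k. (e i)\<^sup>2) / D"
proof (induction k)
  case (Suc k)
  define A where "A = (\<lambda>k. 4 * L * D powr (\<nu> - 1) * real k powr ((1 - \<nu>) / 2))"
  define S where "S = (\<lambda>k. sqrt (\<Sum>i<k. (e i)\<^sup>2) / D)"
  define H where "H = usgm_H B D x s"
  define r where "r = pnorm B (x (Suc k) - x k)"
  define \<beta> where "\<beta> = (s (Suc k) - s k) \<bullet> (x (Suc k) - x k)"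
  have r: "0 \<le> r"
    by (simp add: r_def pnorm_nonneg B)
  have IH: "H k \<le> A k + S k"
    using Suc by (simp add: A_def S_def H_def)
  have "A k \<le> A (Suc k)"
    unfolding A_def using L D \<nu> by (intro mult_left_mono powr_mono2) auto
  moreover have "S k \<le> S (Suc k)"
    unfolding S_def using D by (intro divide_right_mono) auto
  \<comment> \<open>Only genuine growth needs an argument: otherwise \<open>H\<close> keeps its
    value while both summands of the bound are nondecreasing.\<close>
  moreover have "H (Suc k) \<le> A (Suc k) + S (Suc k)"
    if *: "H (Suc k) > H k"
  proof (rule ccontr)
    assume neg: "\<not> ?thesis"
    have eq: "(H (Suc k) - H k) * (D\<^sup>2 + r\<^sup>2 / 2) = max 0 (\<beta> - H k * r\<^sup>2 / 2)"
      using usgm_H_Suc_diff[OF D, of B x s k] by (simp add: H_def r_def \<beta>_def)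
    have "0 < (H (Suc k) - H k) * (D\<^sup>2 + r\<^sup>2 / 2)"
      using * D by (intro mult_pos_pos add_pos_nonneg) auto
    then have "(H (Suc k) - H k) * (D\<^sup>2 + r\<^sup>2 / 2) = \<beta> - H k * r\<^sup>2 / 2"
      using eq by (simp add: max_def split: if_splits)
    then have "D\<^sup>2 * (H (Suc k) - H k) = \<beta> - H (Suc k) * r\<^sup>2 / 2"
      by (simp add: algebra_simps) (simp add: field_simps)
    also have "\<dots> \<le> (L * r powr (1 + \<nu>) + e k * r) - (A (Suc k) + S (Suc k)) * r\<^sup>2 / 2"
    proof -
      have "(A (Suc k) + S (Suc k)) * r\<^sup>2 \<le> H (Suc k) * r\<^sup>2"
        using neg by (intro mult_right_mono) auto
      then show ?thesis
        using curv[of k] by (simp add: \<beta>_def r_def)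
    qed
    also have "\<dots> = (L * r powr (1 + \<nu>) - A (Suc k) * r\<^sup>2 / 2) + (e k * r - S (Suc k) * r\<^sup>2 / 2)"
      by (simp add: field_simps)
    also have "\<dots> \<le> D\<^sup>2 * (A (Suc k) - A k) + D\<^sup>2 * (S (Suc k) - S k)"
    proof (rule add_mono)
      show "L * r powr (1 + \<nu>) - A (Suc k) * r\<^sup>2 / 2 \<le> D\<^sup>2 * (A (Suc k) - A k)"
        unfolding A_def by (rule hoelder_increment[OF D L \<nu> r])
      show "e k * r - S (Suc k) * r\<^sup>2 / 2 \<le> D\<^sup>2 * (S (Suc k) - S k)"
        using noise_increment[OF D, of "\<Sum>i<k. (e i)\<^sup>2" "e k" r]
        by (simp add: S_def sum_nonneg)
    qed
    also have "\<dots> = D\<^sup>2 * ((A (Suc k) - A k) + (S (Suc k) - S k))"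
      by (simp add: distrib_left)
    finally have "H (Suc k) - H k \<le> (A (Suc k) - A k) + (S (Suc k) - S k)"
      using D by (simp add: mult_le_cancel_left_pos)
    then show False
      using IH neg by simp
  qed
  ultimately have "H (Suc k) \<le> A (Suc k) + S (Suc k)"
    using IH by linarith
  then show ?case
    by (simp add: A_def S_def H_def)
qed simp

text \<open>The induction carries the potential \<open>H k / 2 * (d k)\<^sup>2\<close>, because the
  weight of the squared distance changes from step to step. Each increase of \<open>H\<close> is
  charged at most \<open>3 / 2 * D\<^sup>2\<close> for the curvature, by \<open>r \<le> D\<close>,
  and \<open>D\<^sup>2 / 2\<close> for the reweighting, whence \<open>2 * D\<^sup>2\<close>. The
  statement is deterministic: \<open>s\<close> may be any sequence for which the steps are
  minimisers.\<close>

lemma usgm_regret: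
  fixes B :: "real^'n^'n" and f \<psi> :: "real^'n \<Rightarrow> real"
  assumes B: "spd_matrix B" and D: "D > 0" and conv: "convex_on C \<psi>"
    and diam: "\<And>u v. u \<in> C \<Longrightarrow> v \<in> C \<Longrightarrow> pnorm B (u - v) \<le> D"
    and subgrad: "\<And>u v. u \<in> C \<Longrightarrow> v \<in> C \<Longrightarrow> f u + f' u \<bullet> (v - u) \<le> f v"
    and x: "\<And>i. x i \<in> C" and y: "y \<in> C"
    and min: "\<And>i z. z \<in> C \<Longrightarrow>
      s i \<bullet> x (Suc i) + \<psi> (x (Suc i)) + usgm_H B D x s i / 2 * (pnorm B (x (Suc i) - x i))\<^sup>2
      \<le> s i \<bullet> z + \<psi> z + usgm_H B D x s i / 2 * (pnorm B (z - x i))\<^sup>2"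
  shows "(\<Sum>i<k. f (x (Suc i)) + \<psi> (x (Suc i)) - (f y + \<psi> y))
    \<le> 2 * D\<^sup>2 * usgm_H B D x s k
      - (\<Sum>i<k. (s (Suc i) - f' (x (Suc i))) \<bullet> (x (Suc i) - x i) + (s i - f' (x i)) \<bullet> (x i - y))"
proof -
  define H where "H = usgm_H B D x s"
  define d where "d = (\<lambda>i. pnorm B (y - x i))"
  define N where "N = (\<lambda>i. (s (Suc i) - f' (x (Suc i))) \<bullet> (x (Suc i) - x i) + (s i - f' (x i)) \<bullet> (x i - y))"
  have "(\<Sum>i<k. f (x (Suc i)) + \<psi> (x (Suc i)) - (f y + \<psi> y)) + H k / 2 * (d k)\<^sup>2
    \<le> 2 * D\<^sup>2 * H k - (\<Sum>i<k. N i)"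
  proof (induction k)
    case 0
    then show ?case
      by (simp add: H_def)
  next
    case (Suc k)
    define r where "r = pnorm B (x (Suc k) - x k)"
    define \<beta> where "\<beta> = (s (Suc k) - s k) \<bullet> (x (Suc k) - x k)"
    have prox: "s k \<bullet> x (Suc k) + \<psi> (x (Suc k)) + H k / 2 * r\<^sup>2 + H k / 2 * (d (Suc k))\<^sup>2
        \<le> s k \<bullet> y + \<psi> y + H k / 2 * (d k)\<^sup>2"
      unfolding r_def d_def H_def by (rule proximal_step[OF B conv x y min])
    have "f (x k) + f' (x k) \<bullet> (y - x k) \<le> f y"
      "f (x (Suc k)) + f' (x (Suc k)) \<bullet> (x k - x (Suc k)) \<le> f (x k)"
      using subgrad x y by auto
    with prox have 1: "f (x (Suc k)) + \<psi> (x (Suc k)) - (f y + \<psi> y)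
        \<le> \<beta> - H k * r\<^sup>2 / 2 + H k / 2 * (d k)\<^sup>2 - H k / 2 * (d (Suc k))\<^sup>2 - N k"
      by (simp add: \<beta>_def N_def inner_diff_left inner_diff_right)
    have mono: "H k \<le> H (Suc k)"
      by (simp add: H_def usgm_H_le_Suc del: usgm_H.simps)
    have sq: "r\<^sup>2 \<le> D\<^sup>2" "(d (Suc k))\<^sup>2 \<le> D\<^sup>2"
      unfolding r_def d_def using diam x y by (auto intro!: power_mono pnorm_nonneg B)
    have "\<beta> - H k * r\<^sup>2 / 2 \<le> (H (Suc k) - H k) * (D\<^sup>2 + r\<^sup>2 / 2)"
      using usgm_H_Suc_diff[OF D, of B x s k] by (simp add: H_def r_def \<beta>_def)
    also have "\<dots> \<le> (H (Suc k) - H k) * (D\<^sup>2 + D\<^sup>2 / 2)"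
      using mono sq by (intro mult_left_mono) auto
    finally have 2: "\<beta> - H k * r\<^sup>2 / 2 \<le> (H (Suc k) - H k) * (D\<^sup>2 + D\<^sup>2 / 2)" .
    have 3: "(H (Suc k) - H k) * (d (Suc k))\<^sup>2 \<le> (H (Suc k) - H k) * D\<^sup>2"
      using mono sq by (intro mult_left_mono) auto
    from Suc.IH 1 2 3 show ?case
      by (simp add: algebra_simps)
  qed
  moreover have "0 \<le> H k / 2 * (d k)\<^sup>2"
    by (simp add: H_def usgm_H_nonneg)
  ultimately show ?thesis
    by (simp add: H_def N_def)
qed

section \<open>The composite problem\<close>

lemma closed_convex_fun_finite:
  assumes "closed_convex_fun h" "x \<in> edom h"
  shows "ereal (real_of_ereal (h x)) = h x"
  using assms by (cases "h x") (auto simp: closed_convex_fun_def edom_def)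

lemma mem_eepigraph_real:
  assumes "closed_convex_fun h" "x \<in> edom h"
  shows "(x, real_of_ereal (h x)) \<in> eepigraph h"
  using closed_convex_fun_finite[OF assms] by (simp add: eepigraph_def)

lemma convex_on_real_of_ereal:
  assumes h: "closed_convex_fun h"
  shows "convex_on (edom h) (\<lambda>x. real_of_ereal (h x))"
proof -
  have conv: "convex (eepigraph h)"
    using h by (simp add: closed_convex_fun_def)
  have *: "h ((1 - t) *\<^sub>R x + t *\<^sub>R y)
      \<le> ereal ((1 - t) * real_of_ereal (h x) + t * real_of_ereal (h y))"
    if "x \<in> edom h" "y \<in> edom h" "0 \<le> t" "t \<le> 1" for x y and t :: real
    using convexD[OF conv mem_eepigraph_real[OF h that(1)] mem_eepigraph_real[OF h that(2)], of "1 - t" t]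
      that(3,4)
    by (simp add: eepigraph_def)
  have dom: "(1 - t) *\<^sub>R x + t *\<^sub>R y \<in> edom h"
    if "x \<in> edom h" "y \<in> edom h" "0 \<le> t" "t \<le> 1" for x y and t :: real
    using *[OF that] by (auto simp: edom_def)
  show ?thesis
  proof
    show "convex (edom h)"
      unfolding convex_alt using dom by blast
  next
    fix t :: real and x y
    assume t: "0 < t" "t < 1" "x \<in> edom h" "y \<in> edom h"
    then have "ereal (real_of_ereal (h ((1 - t) *\<^sub>R x + t *\<^sub>R y)))
        \<le> ereal ((1 - t) * real_of_ereal (h x) + t * real_of_ereal (h y))"
      using closed_convex_fun_finite[OF h dom[of x y t]] *[of x y t] by simp
    then show "real_of_ereal (h ((1 - t) *\<^sub>R x + t *\<^sub>R y))
        \<le> (1 - t) * real_of_ereal (h x) + t * real_of_ereal (h y)"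
      by simp
  qed
qed

text \<open>A sublevel set is the slice of the closed epigraph at height \<open>t\<close>. Both
  Borel measurability and lower semicontinuity are drawn from this.\<close>

lemma closed_sublevel:
  assumes "closed_convex_fun h"
  shows "closed {x. h x \<le> ereal t}"
proof -
  have "closed ((\<lambda>x. (x, t)) -` eepigraph h)"
    using assms by (intro closed_vimage) (auto simp: closed_convex_fun_def intro!: continuous_intros)
  then show ?thesis
    by (simp add: eepigraph_def vimage_def)
qed

lemma borel_measurable_closed_convex_fun:
  assumes "closed_convex_fun h"
  shows "h \<in> borel_measurable borel"
proof -
  have "h -` {..a} \<in> sets borel" for a
  proof (cases a)
    case (real t)
    then show ?thesis
      using closed_sublevel[OF assms, of t] by (simp add: vimage_def borel_closed)
  next
    case MInf
    then show ?thesis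
      using assms by (auto simp: closed_convex_fun_def vimage_def)
  next
    case PInf
    then show ?thesis
      by (simp add: vimage_def)
  qed
  then show ?thesis
    by (simp add: borel_measurable_iff_Iic_ereal)
qed

lemma closed_convex_fun_le_liminf:
  fixes h :: "'a::euclidean_space \<Rightarrow> ereal"
  assumes h: "closed_convex_fun h" and u: "u \<longlonglongrightarrow> x"
  shows "h x \<le> liminf (\<lambda>n. h (u n))"
proof -
  have "eventually (\<lambda>n. y < h (u n)) sequentially" if y: "y < h x" for y
  proof -
    obtain t where t: "y < ereal t" "ereal t < h x"
      using ereal_dense2[OF y] by blast
    have "open (- {z. h z \<le> ereal t})"
      using closed_sublevel[OF h] by (simp add: open_Compl)
    moreover have "x \<in> - {z. h z \<le> ereal t}"
      using t(2) by simp
    ultimately have "eventually (\<lambda>n. u n \<in> - {z. h z \<le> ereal t}) sequentially"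
      using u topological_tendstoD by blast
    then show ?thesis
      by eventually_elim (use t(1) in auto)
  qed
  then show ?thesis
    by (simp add: le_Liminf_iff)
qed

lemma composite_problem_finite:
  assumes "composite_problem f \<psi>" "x \<in> edom \<psi>"
  shows "x \<in> edom f" and "ereal (real_of_ereal (f x)) = f x" "ereal (real_of_ereal (\<psi> x)) = \<psi> x"
    and "objective f \<psi> x = ereal (real_of_ereal (f x) + real_of_ereal (\<psi> x))"
proof -
  obtain U where "edom \<psi> \<subseteq> U" "\<forall>x\<in>U. \<bar>f x\<bar> \<noteq> \<infinity> \<and> subdifferential f x \<noteq> {}"
    using assms(1) unfolding composite_problem_def by metis
  then have "\<bar>f x\<bar> \<noteq> \<infinity>"
    using assms(2) by (meson subsetD)
  then show "x \<in> edom f" and f: "ereal (real_of_ereal (f x)) = f x"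
    by (auto simp: edom_def)
  show \<psi>: "ereal (real_of_ereal (\<psi> x)) = \<psi> x"
    using assms by (intro closed_convex_fun_finite) (simp_all add: composite_problem_def)
  show "objective f \<psi> x = ereal (real_of_ereal (f x) + real_of_ereal (\<psi> x))"
    unfolding objective_def by (metis \<psi> f plus_ereal.simps(1))
qed

lemma composite_problem_convex_on:
  assumes "composite_problem f \<psi>"
  shows "convex_on (edom \<psi>) (\<lambda>x. real_of_ereal (f x))"
    and "convex_on (edom \<psi>) (\<lambda>x. real_of_ereal (\<psi> x))"
proof -
  show \<psi>: "convex_on (edom \<psi>) (\<lambda>x. real_of_ereal (\<psi> x))"
    using assms by (intro convex_on_real_of_ereal) (simp add: composite_problem_def)
  have "convex_on (edom f) (\<lambda>x. real_of_ereal (f x))"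
    using assms by (intro convex_on_real_of_ereal) (simp add: composite_problem_def)
  then show "convex_on (edom \<psi>) (\<lambda>x. real_of_ereal (f x))"
    by (rule convex_on_subset)
       (use composite_problem_finite(1)[OF assms] convex_on_imp_convex[OF \<psi>] in auto)
qed

lemma subdifferential_ineq:
  assumes P: "composite_problem f \<psi>" and u: "u \<in> edom \<psi>" and v: "v \<in> edom \<psi>"
    and s: "s \<in> subdifferential f u"
  shows "real_of_ereal (f u) + s \<bullet> (v - u) \<le> real_of_ereal (f v)"
proof -
  have "f u + ereal (s \<bullet> (v - u)) \<le> f v"
    using s by (auto simp: subdifferential_def)
  then have "ereal (real_of_ereal (f u) + s \<bullet> (v - u)) \<le> ereal (real_of_ereal (f v))"
    using composite_problem_finite(2)[OF P u] composite_problem_finite(2)[OF P v]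
    by (metis plus_ereal.simps(1))
  then show ?thesis
    by simp
qed

text \<open>Stated for the inner product rather than the dual norm so that \<open>x = y\<close> is
  included: two subgradients at one point may differ, but their difference is paired with 0.
  Consecutive iterates may coincide, so this case does arise.\<close>

lemma hoelder_const_bound:
  assumes fin: "hoelder_const B f \<psi> \<nu> < \<infinity>" and B: "spd_matrix B"
    and xy: "x \<in> edom \<psi>" "y \<in> edom \<psi>"
    and st: "s \<in> subdifferential f x" "t \<in> subdifferential f y"
  shows "(s - t) \<bullet> (x - y) \<le> enn2real (hoelder_const B f \<psi> \<nu>) * pnorm B (x - y) powr (1 + \<nu>)"
proof (cases "x = y")
  case False
  let ?L = "enn2real (hoelder_const B f \<psi> \<nu>)" and ?r = "pnorm B (x - y)"
  have r: "?r > 0"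
    using False by (intro pnorm_pos[OF B]) simp
  have "ennreal (dnorm B (s - t) / ?r powr \<nu>) \<le> hoelder_const B f \<psi> \<nu>"
    unfolding hoelder_const_def using False xy st by (intro Sup_upper) blast
  also have "\<dots> = ennreal ?L"
    using fin by (simp add: less_top)
  finally have "dnorm B (s - t) \<le> ?L * ?r powr \<nu>"
    using r by (simp add: ennreal_le_iff divide_le_eq)
  then have "dnorm B (s - t) * ?r \<le> ?L * ?r powr \<nu> * ?r"
    using r by (intro mult_right_mono) auto
  also have "\<dots> = ?L * ?r powr (1 + \<nu>)"
    using r by (simp add: powr_add)
  finally show ?thesis
    using inner_le_dnorm_pnorm[OF B, of "s - t" "x - y"] by linarith
qed simp

text \<open>The direct method: a minimising sequence in a bounded set, a convergent subsequence, and
  lower semicontinuity of \<open>f\<close> and \<open>\<psi>\<close> separately.\<close>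

lemma composite_problem_attains:
  fixes f \<psi> :: "real^'n \<Rightarrow> ereal"
  assumes P: "composite_problem f \<psi>" and bdd: "bounded (edom \<psi>)"
  shows "\<exists>x\<in>edom \<psi>. objective f \<psi> x = opt_value f \<psi>"
proof -
  have f: "closed_convex_fun f" and \<psi>: "closed_convex_fun \<psi>" and ne: "edom \<psi> \<noteq> {}"
    using P by (auto simp: composite_problem_def)
  obtain v where v: "range v \<subseteq> objective f \<psi> ` edom \<psi>" "v \<longlonglongrightarrow> opt_value f \<psi>"
    using Inf_as_limit[of "objective f \<psi> ` edom \<psi>"] ne by (auto simp: opt_value_def)
  have "\<forall>n. \<exists>z\<in>edom \<psi>. v n = objective f \<psi> z"
    using v(1) by blast
  then obtain u where u: "\<And>n. u n \<in> edom \<psi>" "\<And>n. v n = objective f \<psi> (u n)"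
    by metis
  have "bounded (range u)"
    using bdd u(1) by (metis bounded_subset image_subsetI)
  then obtain x \<rho> where \<rho>: "strict_mono \<rho>" "(u \<circ> \<rho>) \<longlonglongrightarrow> x"
    using bounded_imp_convergent_subsequence by blast
  have lim: "(\<lambda>n. objective f \<psi> (u (\<rho> n))) \<longlonglongrightarrow> opt_value f \<psi>"
    using LIMSEQ_subseq_LIMSEQ[OF v(2) \<rho>(1)] u(2) by (simp add: o_def)
  have lf: "f x \<le> liminf (\<lambda>n. f (u (\<rho> n)))" and l\<psi>: "\<psi> x \<le> liminf (\<lambda>n. \<psi> (u (\<rho> n)))"
    using closed_convex_fun_le_liminf[OF f \<rho>(2)] closed_convex_fun_le_liminf[OF \<psi> \<rho>(2)]
    by (simp_all add: o_def)
  \<comment> \<open>Rules out the indeterminate sum of opposite infinities when the lower limits are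
    added.\<close>
  have fin: "f x \<noteq> - \<infinity>" "\<psi> x \<noteq> - \<infinity>"
    using f \<psi> by (auto simp: closed_convex_fun_def)
  then have ninf: "liminf (\<lambda>n. f (u (\<rho> n))) \<noteq> - \<infinity>" "liminf (\<lambda>n. \<psi> (u (\<rho> n))) \<noteq> - \<infinity>"
    using lf l\<psi> by auto
  have "f x + \<psi> x \<le> liminf (\<lambda>n. f (u (\<rho> n))) + liminf (\<lambda>n. \<psi> (u (\<rho> n)))"
    using lf l\<psi> by (rule add_mono)
  also have "\<dots> \<le> liminf (\<lambda>n. f (u (\<rho> n)) + \<psi> (u (\<rho> n)))"
    using ninf by (intro ereal_liminf_add_mono) auto
  also have "\<dots> = opt_value f \<psi>"
    using lim by (simp add: objective_def lim_imp_Liminf)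
  finally have le: "f x + \<psi> x \<le> opt_value f \<psi>" .
  obtain z where z: "z \<in> edom \<psi>"
    using ne by blast
  have "opt_value f \<psi> \<le> objective f \<psi> z"
    unfolding opt_value_def using z by (rule INF_lower)
  also have "\<dots> < \<infinity>"
    using composite_problem_finite(4)[OF P z] by simp
  \<comment> \<open>A priori the limit lies only in the closure of the domain; finiteness of its
    value puts it inside.\<close>
  finally have "f x + \<psi> x < \<infinity>"
    using le by order
  then have x: "x \<in> edom \<psi>"
    using fin by (cases "f x"; cases "\<psi> x") (auto simp: edom_def)
  then have "opt_value f \<psi> \<le> objective f \<psi> x"
    unfolding opt_value_def by (rule INF_lower)
  with le x show ?thesis
    by (auto simp: objective_def intro!: bexI[of _ x])
qed

section \<open>Oracle noise\<close>

text \<open>Only the sampling protocol. How the query points are chosen is left open, so the facts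
  on the noise hold for every rule whose points are fixed before the query.\<close>

locale oracle_run = prob_space M for M :: "'w measure" +
  fixes B :: "real^'n^'n" and f \<psi> :: "real^'n \<Rightarrow> ereal"
    and P :: "'z measure" and g :: "real^'n \<Rightarrow> 'z \<Rightarrow> real^'n"
    and Z :: "nat \<Rightarrow> 'w \<Rightarrow> 'z" and X :: "nat \<Rightarrow> 'w \<Rightarrow> real^'n"
  assumes spd: "spd_matrix B"
    and unbiased: "unbiased_oracle f \<psi> P g"
    and finite_variance: "oracle_variance B \<psi> P g < \<infinity>"
    and fresh: "fresh_samples M P Z X"
    and X_dom: "\<omega> \<in> space M \<Longrightarrow> X k \<omega> \<in> edom \<psi>"
begin

sublocale P: prob_space P
  using unbiased by (simp add: unbiased_oracle_def)

abbreviation "dom_borel \<equiv> restrict_space borel (edom \<psi>)"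

definition noise :: "real^'n \<Rightarrow> 'z \<Rightarrow> real^'n" where
  "noise x z = g x z - oracle_mean P g x"

text \<open>Packages the \<sigma>-algebra of \<open>past_events\<close> as a measure, so that "known
  before query \<open>k\<close>" becomes a measurability statement.\<close>

definition past :: "nat \<Rightarrow> 'w measure" where
  "past k = sigma (space M)
     ({Z i -` A \<inter> space M | i A. i < k \<and> A \<in> sets P} \<union>
      {X i -` A \<inter> space M | i A. i \<le> k \<and> A \<in> sets borel})"

lemma space_past [simp]: "space (past k) = space M"
  unfolding past_def by (rule space_measure_of) auto

lemma sets_past: "sets (past k) = past_events M P Z X k"
  unfolding past_def past_events_def by (rule sets_measure_of) auto

lemma X_measurable: "X k \<in> M \<rightarrow>\<^sub>M borel"
  using fresh by (simp add: fresh_samples_def)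

text \<open>The oracle map is measurable only over the domain of \<open>\<psi>\<close>, so the
  iterates must be maps into the restricted space before they can be composed with it.\<close>

lemma X_measurable_dom [measurable]: "X k \<in> M \<rightarrow>\<^sub>M dom_borel"
  using X_measurable X_dom by (intro measurable_restrict_space2) auto

lemma Z_measurable [measurable]: "Z k \<in> M \<rightarrow>\<^sub>M P"
  using fresh by (simp add: fresh_samples_def)

lemma X_measurable_past: "i \<le> k \<Longrightarrow> X i \<in> past k \<rightarrow>\<^sub>M borel"
  by (rule measurableI) (auto simp: sets_past past_events_def intro!: sigma_sets.Basic)

lemma X_measurable_past_dom: "i \<le> k \<Longrightarrow> X i \<in> past k \<rightarrow>\<^sub>M dom_borel"
  using X_measurable_past X_dom by (intro measurable_restrict_space2) auto

lemma sets_past_le: "sets (past k) \<subseteq> sets M"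
  unfolding past_def using X_measurable Z_measurable
  by (subst sets_measure_of) (auto intro!: sets.sigma_sets_subset dest: measurable_sets)

lemma measurable_from_past: "V \<in> past k \<rightarrow>\<^sub>M N \<Longrightarrow> V \<in> M \<rightarrow>\<^sub>M N"
  using sets_past_le[of k] unfolding measurable_def by auto

text \<open>Independence makes the two laws agree on rectangles, and a product of \<sigma>-finite
  measures is determined there. This is what lets Fubini integrate the fresh sample with everything
  earlier held fixed.\<close>

lemma distr_past_sample:
  assumes V: "V \<in> past k \<rightarrow>\<^sub>M N"
  shows "distr M (N \<Otimes>\<^sub>M P) (\<lambda>\<omega>. (V \<omega>, Z k \<omega>)) = distr M N V \<Otimes>\<^sub>M P"
proof -
  have [measurable]: "V \<in> M \<rightarrow>\<^sub>M N"
    by (rule measurable_from_past[OF V])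
  have indep: "indep_set (sigma_sets (space M) {Z k -` A \<inter> space M | A. A \<in> sets P}) (sets (past k))"
    using fresh by (simp add: fresh_samples_def sets_past)
  interpret V: prob_space "distr M N V"
    by (rule prob_space_distr) measurable
  show ?thesis
  proof (rule pair_measure_eqI[symmetric])
    fix A C
    assume "A \<in> sets (distr M N V)" and C: "C \<in> sets P"
    then have A: "A \<in> sets N"
      by simp
    have ZC: "Z k -` C \<inter> space M \<in> sigma_sets (space M) {Z k -` A \<inter> space M | A. A \<in> sets P}"
      using C by blast
    have VA: "V -` A \<inter> space M \<in> sets (past k)"
      using measurable_sets[OF V A] by simp
    have "emeasure P C = emeasure (distr M P (Z k)) C"
      using fresh by (simp add: fresh_samples_def)
    also have "\<dots> = prob (Z k -` C \<inter> space M)"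
      using C by (simp add: emeasure_distr emeasure_eq_measure)
    finally have "emeasure (distr M N V) A * emeasure P C
        = ennreal (prob (Z k -` C \<inter> space M) * prob (V -` A \<inter> space M))"
      using A by (simp add: emeasure_distr emeasure_eq_measure ennreal_mult mult.commute)
    also have "\<dots> = prob ((Z k -` C \<inter> space M) \<inter> (V -` A \<inter> space M))"
      by (simp add: indep_setD[OF indep ZC VA])
    also have "(Z k -` C \<inter> space M) \<inter> (V -` A \<inter> space M) = (\<lambda>\<omega>. (V \<omega>, Z k \<omega>)) -` (A \<times> C) \<inter> space M"
      by auto
    also have "ennreal (prob \<dots>) = emeasure (distr M (N \<Otimes>\<^sub>M P) (\<lambda>\<omega>. (V \<omega>, Z k \<omega>))) (A \<times> C)"
      using A C by (simp add: emeasure_distr emeasure_eq_measure)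
    finally show "emeasure (distr M N V) A * emeasure P C
        = emeasure (distr M (N \<Otimes>\<^sub>M P) (\<lambda>\<omega>. (V \<omega>, Z k \<omega>))) (A \<times> C)" .
  qed (auto intro: V.sigma_finite_measure_axioms P.sigma_finite_measure_axioms
        cong: sets_pair_measure_cong)
qed

lemma g_measurable: "(\<lambda>(x, z). g x z) \<in> borel_measurable (dom_borel \<Otimes>\<^sub>M P)"
  using unbiased by (simp add: unbiased_oracle_def)

lemma noise_measurable [measurable]: "(\<lambda>(x, z). noise x z) \<in> borel_measurable (dom_borel \<Otimes>\<^sub>M P)"
proof -
  have [measurable]: "(\<lambda>(x, z). g x z) \<in> borel_measurable (dom_borel \<Otimes>\<^sub>M P)"
    by (rule g_measurable)
  \<comment> \<open>The mean is a selection of subgradients; its measurability comes from being a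
    parameter integral of a jointly measurable map.\<close>
  have [measurable]: "oracle_mean P g \<in> borel_measurable dom_borel"
    unfolding oracle_mean_def by measurable
  show ?thesis
    unfolding noise_def by measurable
qed

lemma noise_run_measurable [measurable]:
  "(\<lambda>\<omega>. noise (X k \<omega>) (Z k \<omega>)) \<in> borel_measurable M"
  using measurable_compose[OF measurable_Pair[OF X_measurable_dom Z_measurable] noise_measurable]
  by simp

lemma noise_integral_0:
  assumes "x \<in> edom \<psi>"
  shows "(\<integral>z. noise x z \<bullet> v \<partial>P) = 0"
proof -
  have int: "integrable P (g x)"
    using unbiased assms by (simp add: unbiased_oracle_def)
  then have "integrable P (\<lambda>z. noise x z)" "(\<integral>z. noise x z \<partial>P) = 0"
    by (simp_all add: noise_def oracle_mean_def P.prob_space)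
  then show ?thesis
    by simp
qed

lemma oracle_variance_eq: "oracle_variance B \<psi> P g = ennreal ((oracle_sigma B \<psi> P g)\<^sup>2)"
  using finite_variance by (simp add: oracle_sigma_def)

lemma oracle_sigma_nonneg: "0 \<le> oracle_sigma B \<psi> P g"
  by (simp add: oracle_sigma_def)

text \<open>The variance bound is uniform over the domain, so it survives substituting a random
  query point. The nonnegative integral is used because integrability is obtained only from this
  estimate.\<close>

lemma nn_integral_noise_le:
  "(\<integral>\<^sup>+\<omega>. ennreal ((dnorm B (noise (X k \<omega>) (Z k \<omega>)))\<^sup>2) \<partial>M) \<le> oracle_variance B \<psi> P g"
proof -
  let ?h = "\<lambda>(x, z). ennreal ((dnorm B (noise x z))\<^sup>2)"
  have [measurable]: "?h \<in> borel_measurable (dom_borel \<Otimes>\<^sub>M P)"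
    by measurable
  have "(\<integral>\<^sup>+\<omega>. ennreal ((dnorm B (noise (X k \<omega>) (Z k \<omega>)))\<^sup>2) \<partial>M)
      = (\<integral>\<^sup>+w. ?h w \<partial>distr M (dom_borel \<Otimes>\<^sub>M P) (\<lambda>\<omega>. (X k \<omega>, Z k \<omega>)))"
    by (subst nn_integral_distr) auto
  also have "\<dots> = (\<integral>\<^sup>+w. ?h w \<partial>(distr M dom_borel (X k) \<Otimes>\<^sub>M P))"
    by (simp add: distr_past_sample[OF X_measurable_past_dom])
  also have "\<dots> = (\<integral>\<^sup>+x. \<integral>\<^sup>+z. ?h (x, z) \<partial>P \<partial>distr M dom_borel (X k))"
    by (rule P.nn_integral_fst[symmetric]) simp
  also have "\<dots> \<le> (\<integral>\<^sup>+x. oracle_variance B \<psi> P g \<partial>distr M dom_borel (X k))"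
    unfolding oracle_variance_def noise_def
    by (intro nn_integral_mono) (auto simp: space_restrict_space intro!: SUP_upper2)
  also have "\<dots> = oracle_variance B \<psi> P g"
    using prob_space.emeasure_space_1[OF prob_space_distr[OF X_measurable_dom]] by simp
  finally show ?thesis .
qed

lemma
  shows integrable_noise_sq: "integrable M (\<lambda>\<omega>. (dnorm B (noise (X k \<omega>) (Z k \<omega>)))\<^sup>2)"
    and integral_noise_sq_le:
      "(\<integral>\<omega>. (dnorm B (noise (X k \<omega>) (Z k \<omega>)))\<^sup>2 \<partial>M) \<le> (oracle_sigma B \<psi> P g)\<^sup>2"
proof -
  show int: "integrable M (\<lambda>\<omega>. (dnorm B (noise (X k \<omega>) (Z k \<omega>)))\<^sup>2)"
    unfolding integrable_iff_bounded
    using nn_integral_noise_le[of k] finite_variance by (auto intro: le_less_trans)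
  have "ennreal (\<integral>\<omega>. (dnorm B (noise (X k \<omega>) (Z k \<omega>)))\<^sup>2 \<partial>M)
      \<le> ennreal ((oracle_sigma B \<psi> P g)\<^sup>2)"
    using nn_integral_noise_le[of k] nn_integral_eq_integral[OF int] by (simp add: oracle_variance_eq)
  then show "(\<integral>\<omega>. (dnorm B (noise (X k \<omega>) (Z k \<omega>)))\<^sup>2 \<partial>M) \<le> (oracle_sigma B \<psi> P g)\<^sup>2"
    by (simp add: ennreal_le_iff)
qed

lemma integrable_dnorm_noise: "integrable M (\<lambda>\<omega>. dnorm B (noise (X k \<omega>) (Z k \<omega>)))"
  by (rule square_integrable_imp_integrable[OF _ integrable_noise_sq]) measurable

text \<open>The noise is a martingale difference: integrate out the fresh sample first, using Fubini for the
  joint law of the past and the sample.\<close>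

lemma
  assumes V: "V \<in> past k \<rightarrow>\<^sub>M borel" and bound: "\<And>\<omega>. \<omega> \<in> space M \<Longrightarrow> pnorm B (V \<omega>) \<le> D"
  shows integrable_noise_inner: "integrable M (\<lambda>\<omega>. noise (X k \<omega>) (Z k \<omega>) \<bullet> V \<omega>)"
    and integral_noise_inner: "(\<integral>\<omega>. noise (X k \<omega>) (Z k \<omega>) \<bullet> V \<omega> \<partial>M) = 0"
proof -
  have [measurable]: "V \<in> M \<rightarrow>\<^sub>M borel"
    by (rule measurable_from_past[OF V])
  show int: "integrable M (\<lambda>\<omega>. noise (X k \<omega>) (Z k \<omega>) \<bullet> V \<omega>)"
  proof (rule Bochner_Integration.integrable_bound)
    show "integrable M (\<lambda>\<omega>. dnorm B (noise (X k \<omega>) (Z k \<omega>)) * D)"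
      using integrable_dnorm_noise by simp
    show "AE \<omega> in M. norm (noise (X k \<omega>) (Z k \<omega>) \<bullet> V \<omega>) \<le> norm (dnorm B (noise (X k \<omega>) (Z k \<omega>)) * D)"
    proof (rule AE_I2)
      fix \<omega> assume "\<omega> \<in> space M"
      have "\<bar>noise (X k \<omega>) (Z k \<omega>) \<bullet> V \<omega>\<bar> \<le> dnorm B (noise (X k \<omega>) (Z k \<omega>)) * pnorm B (V \<omega>)"
        by (rule abs_inner_le_dnorm_pnorm[OF spd])
      also have "\<dots> \<le> dnorm B (noise (X k \<omega>) (Z k \<omega>)) * D"
        using bound[OF \<open>\<omega> \<in> space M\<close>] by (intro mult_left_mono dnorm_nonneg spd)
      finally show "norm (noise (X k \<omega>) (Z k \<omega>) \<bullet> V \<omega>) \<le> norm (dnorm B (noise (X k \<omega>) (Z k \<omega>)) * D)"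
        by simp
    qed
  qed measurable
  let ?N = "dom_borel \<Otimes>\<^sub>M (borel :: (real^'n) measure)"
  \<comment> \<open>The query point is carried along with \<open>V\<close>: once both are fixed, the
    integral over the sample is that of the centred oracle at a single point.\<close>
  let ?W = "\<lambda>\<omega>. (X k \<omega>, V \<omega>)"
  let ?h = "\<lambda>((x, v), z). noise x z \<bullet> v"
  have W: "?W \<in> past k \<rightarrow>\<^sub>M ?N"
    using X_measurable_past_dom[of k k] V by (intro measurable_Pair) auto
  have [measurable]: "?W \<in> M \<rightarrow>\<^sub>M ?N"
    by (rule measurable_from_past[OF W])
  have "(\<lambda>w. (fst (fst w), snd w)) \<in> ?N \<Otimes>\<^sub>M P \<rightarrow>\<^sub>M dom_borel \<Otimes>\<^sub>M P"
    by measurable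
  from measurable_compose[OF this noise_measurable]
  have [measurable]: "(\<lambda>w. noise (fst (fst w)) (snd w)) \<in> borel_measurable (?N \<Otimes>\<^sub>M P)"
    by simp
  have h [measurable]: "?h \<in> borel_measurable (?N \<Otimes>\<^sub>M P)"
    unfolding split_beta' by (rule borel_measurable_inner) measurable
  interpret W: prob_space "distr M ?N ?W"
    by (rule prob_space_distr) measurable
  interpret pair_sigma_finite "distr M ?N ?W" P ..
  have joint: "distr M (?N \<Otimes>\<^sub>M P) (\<lambda>\<omega>. (?W \<omega>, Z k \<omega>)) = distr M ?N ?W \<Otimes>\<^sub>M P"
    by (rule distr_past_sample[OF W])
  have "integrable (distr M (?N \<Otimes>\<^sub>M P) (\<lambda>\<omega>. (?W \<omega>, Z k \<omega>))) ?h"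
    using int by (subst integrable_distr_eq) auto
  then have "(\<integral>w. (\<integral>z. ?h (w, z) \<partial>P) \<partial>distr M ?N ?W) = integral\<^sup>L (distr M ?N ?W \<Otimes>\<^sub>M P) ?h"
    unfolding joint by (rule integral_fst')
  also have "\<dots> = (\<integral>\<omega>. noise (X k \<omega>) (Z k \<omega>) \<bullet> V \<omega> \<partial>M)"
    unfolding joint[symmetric] by (subst integral_distr) auto
  finally have "(\<integral>\<omega>. noise (X k \<omega>) (Z k \<omega>) \<bullet> V \<omega> \<partial>M)
      = (\<integral>w. (\<integral>z. ?h (w, z) \<partial>P) \<partial>distr M ?N ?W)" ..
  also have "\<dots> = (\<integral>w. 0 \<partial>distr M ?N ?W)"
    by (intro Bochner_Integration.integral_cong)
       (auto simp: space_pair_measure space_restrict_space noise_integral_0)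
  finally show "(\<integral>\<omega>. noise (X k \<omega>) (Z k \<omega>) \<bullet> V \<omega> \<partial>M) = 0"
    by simp
qed

end

text \<open>Jensen's inequality for the square root, read off from the nonnegative variance of
  \<open>sqrt (Y \<omega>)\<close>.\<close>

lemma (in prob_space) expectation_sqrt_le:
  fixes Y :: "'a \<Rightarrow> real"
  assumes int: "integrable M Y" and nonneg: "\<And>\<omega>. \<omega> \<in> space M \<Longrightarrow> 0 \<le> Y \<omega>"
  shows "integrable M (\<lambda>\<omega>. sqrt (Y \<omega>))" and "expectation (\<lambda>\<omega>. sqrt (Y \<omega>)) \<le> sqrt (expectation Y)"
proof -
  have eq: "(sqrt (Y \<omega>))\<^sup>2 = Y \<omega>" if "\<omega> \<in> space M" for \<omega>
    using nonneg[OF that] by simp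
  have sq: "integrable M (\<lambda>\<omega>. (sqrt (Y \<omega>))\<^sup>2)" "expectation (\<lambda>\<omega>. (sqrt (Y \<omega>))\<^sup>2) = expectation Y"
    using int Bochner_Integration.integrable_cong[OF refl eq, of M "\<lambda>\<omega>. \<omega>"]
      Bochner_Integration.integral_cong[OF refl eq, of M "\<lambda>\<omega>. \<omega>"] by simp_all
  have [measurable]: "Y \<in> borel_measurable M"
    using int by (rule borel_measurable_integrable)
  show i: "integrable M (\<lambda>\<omega>. sqrt (Y \<omega>))"
    by (rule square_integrable_imp_integrable[OF _ sq(1)]) measurable
  have "(expectation (\<lambda>\<omega>. sqrt (Y \<omega>)))\<^sup>2 \<le> expectation Y"
    using variance_positive[of "\<lambda>\<omega>. sqrt (Y \<omega>)"] variance_eq[OF i sq(1)] sq(2) by simp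
  then show "expectation (\<lambda>\<omega>. sqrt (Y \<omega>)) \<le> sqrt (expectation Y)"
    by (rule real_le_rsqrt)
qed

section \<open>Expected optimality gap\<close>

locale usgm_run = oracle_run M B f \<psi> P g Z X
  for M :: "'w measure" and B :: "real^'n^'n" and f \<psi> :: "real^'n \<Rightarrow> ereal"
    and P :: "'z measure" and g :: "real^'n \<Rightarrow> 'z \<Rightarrow> real^'n"
    and Z :: "nat \<Rightarrow> 'w \<Rightarrow> 'z" and X :: "nat \<Rightarrow> 'w \<Rightarrow> real^'n" +
  fixes D :: real and x0 :: "real^'n"
  assumes problem: "composite_problem f \<psi>"
    and D_pos: "D > 0"
    and diam: "\<lbrakk>x \<in> edom \<psi>; y \<in> edom \<psi>\<rbrakk> \<Longrightarrow> pnorm B (x - y) \<le> D"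
    and trajectory: "\<omega> \<in> space M \<Longrightarrow>
      usgm_trajectory B \<psi> D x0 (\<lambda>k. X k \<omega>) (\<lambda>k. g (X k \<omega>) (Z k \<omega>))"
begin

abbreviation F :: "real^'n \<Rightarrow> real" where
  "F x \<equiv> real_of_ereal (objective f \<psi> x)"

abbreviation \<sigma> :: real where
  "\<sigma> \<equiv> oracle_sigma B \<psi> P g"

abbreviation \<delta> :: "nat \<Rightarrow> 'w \<Rightarrow> real^'n" where
  "\<delta> k \<omega> \<equiv> noise (X k \<omega>) (Z k \<omega>)"

abbreviation H :: "nat \<Rightarrow> 'w \<Rightarrow> real" where
  "H k \<omega> \<equiv> usgm_H B D (\<lambda>k. X k \<omega>) (\<lambda>k. g (X k \<omega>) (Z k \<omega>)) k"

lemma F_eq: "x \<in> edom \<psi> \<Longrightarrow> F x = real_of_ereal (f x) + real_of_ereal (\<psi> x)"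
  by (simp add: composite_problem_finite(4)[OF problem])

lemma oracle_mean_subgradient:
  "x \<in> edom \<psi> \<Longrightarrow> oracle_mean P g x \<in> subdifferential f x"
  using unbiased by (simp add: unbiased_oracle_def)

lemma X_Suc_minimal:
  assumes \<omega>: "\<omega> \<in> space M" and z: "z \<in> edom \<psi>"
  shows "g (X i \<omega>) (Z i \<omega>) \<bullet> X (Suc i) \<omega> + real_of_ereal (\<psi> (X (Suc i) \<omega>))
        + H i \<omega> / 2 * (pnorm B (X (Suc i) \<omega> - X i \<omega>))\<^sup>2
      \<le> g (X i \<omega>) (Z i \<omega>) \<bullet> z + real_of_ereal (\<psi> z) + H i \<omega> / 2 * (pnorm B (z - X i \<omega>))\<^sup>2"
    (is "?l \<le> ?r")
proof -
  let ?\<phi> = "\<lambda>y. ereal (g (X i \<omega>) (Z i \<omega>) \<bullet> y) + \<psi> y + ereal (H i \<omega> / 2 * (pnorm B (y - X i \<omega>))\<^sup>2)"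
  have \<phi>: "?\<phi> y = ereal (g (X i \<omega>) (Z i \<omega>) \<bullet> y + real_of_ereal (\<psi> y) + H i \<omega> / 2 * (pnorm B (y - X i \<omega>))\<^sup>2)"
    if "y \<in> edom \<psi>" for y
    by (subst composite_problem_finite(3)[OF problem that, symmetric]) simp
  have "is_arg_min ?\<phi> (\<lambda>y. y \<in> edom \<psi>) (X (Suc i) \<omega>)"
    using trajectory[OF \<omega>] by (simp add: usgm_trajectory_def)
  then have "?\<phi> (X (Suc i) \<omega>) \<le> ?\<phi> z"
    using z unfolding is_arg_min_def by (meson not_le)
  then have "ereal ?l \<le> ereal ?r"
    by (simp only: \<phi>[OF z] \<phi>[OF X_dom[OF \<omega>]])
  then show ?thesis
    by simp
qed

lemma regret:
  assumes \<omega>: "\<omega> \<in> space M" and y: "y \<in> edom \<psi>"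
  shows "(\<Sum>i<k. F (X (Suc i) \<omega>) - F y) \<le> 2 * D\<^sup>2 * H k \<omega>
    - (\<Sum>i<k. \<delta> (Suc i) \<omega> \<bullet> (X (Suc i) \<omega> - X i \<omega>) + \<delta> i \<omega> \<bullet> (X i \<omega> - y))"
  using usgm_regret[OF spd D_pos composite_problem_convex_on(2)[OF problem] diam
      subdifferential_ineq[OF problem _ _ oracle_mean_subgradient] X_dom[OF \<omega>] y X_Suc_minimal[OF \<omega>],
      where k = k]
  by (simp add: F_eq X_dom[OF \<omega>] y noise_def)

text \<open>A difference of samples is a difference of means, which are subgradients and obey the
  Hoelder bound, plus a difference of noise vectors, which duality bounds by its dual norm times the
  step length.\<close>

lemma H_bound:
  assumes \<omega>: "\<omega> \<in> space M" and \<nu>: "0 \<le> \<nu>" "\<nu> \<le> 1" and fin: "hoelder_const B f \<psi> \<nu> < \<infinity>"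
  shows "H k \<omega> \<le> 4 * enn2real (hoelder_const B f \<psi> \<nu>) * D powr (\<nu> - 1) * real k powr ((1 - \<nu>) / 2)
    + sqrt (\<Sum>i<k. (dnorm B (\<delta> (Suc i) \<omega> - \<delta> i \<omega>))\<^sup>2) / D"
proof (rule usgm_H_bound[OF spd D_pos _ \<nu>])
  fix i
  let ?u = "X (Suc i) \<omega>" and ?v = "X i \<omega>"
  have "(oracle_mean P g ?u - oracle_mean P g ?v) \<bullet> (?u - ?v)
      \<le> enn2real (hoelder_const B f \<psi> \<nu>) * pnorm B (?u - ?v) powr (1 + \<nu>)"
    using X_dom[OF \<omega>] by (intro hoelder_const_bound[OF fin spd] oracle_mean_subgradient)
  moreover have "(\<delta> (Suc i) \<omega> - \<delta> i \<omega>) \<bullet> (?u - ?v)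
      \<le> dnorm B (\<delta> (Suc i) \<omega> - \<delta> i \<omega>) * pnorm B (?u - ?v)"
    by (rule inner_le_dnorm_pnorm[OF spd])
  ultimately show "(g ?u (Z (Suc i) \<omega>) - g ?v (Z i \<omega>)) \<bullet> (?u - ?v)
      \<le> enn2real (hoelder_const B f \<psi> \<nu>) * pnorm B (?u - ?v) powr (1 + \<nu>)
        + dnorm B (\<delta> (Suc i) \<omega> - \<delta> i \<omega>) * pnorm B (?u - ?v)"
    by (simp add: noise_def inner_diff_left)
qed simp

lemma usgm_average_eq:
  "usgm_average X k \<omega> = (\<Sum>i<k. (1 / real k) *\<^sub>R X (Suc i) \<omega>)"
  unfolding usgm_average_def scaleR_sum_right
  by (rule sum.reindex_bij_witness[of _ Suc "\<lambda>i. i - 1"]) auto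

lemma usgm_average_dom:
  assumes \<omega>: "\<omega> \<in> space M" and k: "k \<ge> 1"
  shows "usgm_average X k \<omega> \<in> edom \<psi>"
  unfolding usgm_average_eq
  using convex_on_imp_convex[OF composite_problem_convex_on(2)[OF problem]] X_dom[OF \<omega>] k
  by (intro convex_sum) auto

text \<open>Jensen's inequality, multiplied by \<open>k\<close> so that it chains with the regret
  sum. The average and the sum run over the same points, from \<open>X 1\<close> to
  \<open>X k\<close>.\<close>

lemma F_usgm_average_le:
  assumes \<omega>: "\<omega> \<in> space M" and k: "k \<ge> 1"
  shows "real k * (F (usgm_average X k \<omega>) - c) \<le> (\<Sum>i<k. F (X (Suc i) \<omega>) - c)"
proof -
  let ?G = "\<lambda>x. real_of_ereal (f x) + real_of_ereal (\<psi> x)"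
  have "convex_on (edom \<psi>) ?G"
    by (intro convex_on_add composite_problem_convex_on[OF problem])
  then have "?G (usgm_average X k \<omega>) \<le> (\<Sum>i<k. (1 / real k) * ?G (X (Suc i) \<omega>))"
    unfolding usgm_average_eq using X_dom[OF \<omega>] k by (intro convex_on_sum) (auto simp: lessThan_empty_iff)
  also have "\<dots> = (\<Sum>i<k. F (X (Suc i) \<omega>)) / real k"
    by (simp add: F_eq X_dom[OF \<omega>] sum_divide_distrib)
  finally have "F (usgm_average X k \<omega>) \<le> (\<Sum>i<k. F (X (Suc i) \<omega>)) / real k"
    by (simp add: F_eq usgm_average_dom[OF \<omega> k])
  then have "real k * F (usgm_average X k \<omega>) \<le> (\<Sum>i<k. F (X (Suc i) \<omega>))"
    using k by (simp add: field_simps)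
  then show ?thesis
    by (simp add: sum_subtractf right_diff_distrib)
qed

lemma F_usgm_average_measurable: "(\<lambda>\<omega>. F (usgm_average X k \<omega>)) \<in> borel_measurable M"
proof -
  have [measurable]: "f \<in> borel_measurable borel" "\<psi> \<in> borel_measurable borel"
    using problem by (auto simp: composite_problem_def intro: borel_measurable_closed_convex_fun)
  have [measurable]: "X i \<in> borel_measurable M" for i
    by (rule X_measurable)
  show ?thesis
    unfolding usgm_average_def objective_def by measurable
qed

text \<open>The factor 4 is 2 + 2 from the parallelogram estimate; orthogonality of consecutive
  noise vectors is not invoked.\<close>

lemma
  shows integrable_noise_increments: "integrable M (\<lambda>\<omega>. \<Sum>i<k. (dnorm B (\<delta> (Suc i) \<omega> - \<delta> i \<omega>))\<^sup>2)"
    and integral_noise_increments: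
      "expectation (\<lambda>\<omega>. \<Sum>i<k. (dnorm B (\<delta> (Suc i) \<omega> - \<delta> i \<omega>))\<^sup>2) \<le> 4 * real k * \<sigma>\<^sup>2"
proof -
  let ?U = "\<lambda>i \<omega>. 2 * (dnorm B (\<delta> (Suc i) \<omega>))\<^sup>2 + 2 * (dnorm B (\<delta> i \<omega>))\<^sup>2"
  have U: "integrable M (?U i)" for i
    by (intro Bochner_Integration.integrable_add integrable_mult_right integrable_noise_sq)
  have le: "(dnorm B (\<delta> (Suc i) \<omega> - \<delta> i \<omega>))\<^sup>2 \<le> ?U i \<omega>" for i \<omega>
    by (rule dnorm_diff_power2_le[OF spd])
  have int: "integrable M (\<lambda>\<omega>. (dnorm B (\<delta> (Suc i) \<omega> - \<delta> i \<omega>))\<^sup>2)" for i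
    by (rule Bochner_Integration.integrable_bound[OF U[of i]]) (measurable, use le in auto)
  then show "integrable M (\<lambda>\<omega>. \<Sum>i<k. (dnorm B (\<delta> (Suc i) \<omega> - \<delta> i \<omega>))\<^sup>2)"
    by (intro Bochner_Integration.integrable_sum)
  have "expectation (\<lambda>\<omega>. (dnorm B (\<delta> (Suc i) \<omega> - \<delta> i \<omega>))\<^sup>2) \<le> 4 * \<sigma>\<^sup>2" for i
  proof -
    have "expectation (\<lambda>\<omega>. (dnorm B (\<delta> (Suc i) \<omega> - \<delta> i \<omega>))\<^sup>2) \<le> expectation (?U i)"
      by (intro integral_mono int U le)
    also have "\<dots> = 2 * expectation (\<lambda>\<omega>. (dnorm B (\<delta> (Suc i) \<omega>))\<^sup>2)
        + 2 * expectation (\<lambda>\<omega>. (dnorm B (\<delta> i \<omega>))\<^sup>2)"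
      by (simp add: integrable_noise_sq)
    finally show ?thesis
      using integral_noise_sq_le[of "Suc i"] integral_noise_sq_le[of i] by simp
  qed
  then have "(\<Sum>i<k. expectation (\<lambda>\<omega>. (dnorm B (\<delta> (Suc i) \<omega> - \<delta> i \<omega>))\<^sup>2)) \<le> (\<Sum>i<k. 4 * \<sigma>\<^sup>2)"
    by (intro sum_mono)
  then show "expectation (\<lambda>\<omega>. \<Sum>i<k. (dnorm B (\<delta> (Suc i) \<omega> - \<delta> i \<omega>))\<^sup>2) \<le> 4 * real k * \<sigma>\<^sup>2"
    by (simp add: int)
qed

lemma
  assumes y: "y \<in> edom \<psi>"
  shows integrable_regret_noise:
      "integrable M (\<lambda>\<omega>. \<Sum>i<k. \<delta> (Suc i) \<omega> \<bullet> (X (Suc i) \<omega> - X i \<omega>) + \<delta> i \<omega> \<bullet> (X i \<omega> - y))"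
    and integral_regret_noise:
      "expectation (\<lambda>\<omega>. \<Sum>i<k. \<delta> (Suc i) \<omega> \<bullet> (X (Suc i) \<omega> - X i \<omega>) + \<delta> i \<omega> \<bullet> (X i \<omega> - y)) = 0"
proof -
  \<comment> \<open>The step into \<open>X (Suc i)\<close> is known before query
    \<open>Suc i\<close>, not before query \<open>i\<close>; this is why it is paired with the later
    noise.\<close>
  have V: "(\<lambda>\<omega>. X (Suc i) \<omega> - X i \<omega>) \<in> past (Suc i) \<rightarrow>\<^sub>M borel"
    "(\<lambda>\<omega>. X i \<omega> - y) \<in> past i \<rightarrow>\<^sub>M borel" for i
    by (intro borel_measurable_diff X_measurable_past borel_measurable_const; simp)+
  have b: "\<omega> \<in> space M \<Longrightarrow> pnorm B (X (Suc i) \<omega> - X i \<omega>) \<le> D"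
    "\<omega> \<in> space M \<Longrightarrow> pnorm B (X i \<omega> - y) \<le> D" for i \<omega>
    by (intro diam X_dom y; assumption)+
  note int = integrable_noise_inner[OF V(1) b(1)] integrable_noise_inner[OF V(2) b(2)]
  note zero = integral_noise_inner[OF V(1) b(1)] integral_noise_inner[OF V(2) b(2)]
  show "integrable M (\<lambda>\<omega>. \<Sum>i<k. \<delta> (Suc i) \<omega> \<bullet> (X (Suc i) \<omega> - X i \<omega>) + \<delta> i \<omega> \<bullet> (X i \<omega> - y))"
    by (intro Bochner_Integration.integrable_sum Bochner_Integration.integrable_add int)
  show "expectation (\<lambda>\<omega>. \<Sum>i<k. \<delta> (Suc i) \<omega> \<bullet> (X (Suc i) \<omega> - X i \<omega>) + \<delta> i \<omega> \<bullet> (X i \<omega> - y)) = 0"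
    by (subst Bochner_Integration.integral_sum)
       (simp_all add: int zero Bochner_Integration.integral_add[OF int] Bochner_Integration.integrable_add[OF int])
qed

text \<open>On each trajectory the objective at the average lies between its minimum and the minimum
  plus \<open>U\<close>. As \<open>U\<close> is integrable, this yields integrability and the rate
  at once, without integrating \<open>H\<close> or the objective at single iterates.\<close>

lemma
  assumes y: "y \<in> edom \<psi>" and min: "\<And>x. x \<in> edom \<psi> \<Longrightarrow> F y \<le> F x" and k: "k \<ge> 1"
    and \<nu>: "0 \<le> \<nu>" "\<nu> \<le> 1" and fin: "hoelder_const B f \<psi> \<nu> < \<infinity>"
  shows integrable_F_usgm_average: "integrable M (\<lambda>\<omega>. F (usgm_average X k \<omega>))"
    and expected_gap_le: "expectation (\<lambda>\<omega>. F (usgm_average X k \<omega>)) - F y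
      \<le> 8 * enn2real (hoelder_const B f \<psi> \<nu>) * D powr (1 + \<nu>) / real k powr ((1 + \<nu>) / 2)
        + 4 * \<sigma> * D / sqrt (real k)"
proof -
  define L where "L = enn2real (hoelder_const B f \<psi> \<nu>)"
  define A where "A = 4 * L * D powr (\<nu> - 1) * real k powr ((1 - \<nu>) / 2)"
  define Y where "Y = (\<lambda>\<omega>. \<Sum>i<k. (dnorm B (\<delta> (Suc i) \<omega> - \<delta> i \<omega>))\<^sup>2)"
  define N where "N = (\<lambda>\<omega>. \<Sum>i<k. \<delta> (Suc i) \<omega> \<bullet> (X (Suc i) \<omega> - X i \<omega>) + \<delta> i \<omega> \<bullet> (X i \<omega> - y))"
  define G where "G = (\<lambda>\<omega>. F (usgm_average X k \<omega>))"
  define U where "U = (\<lambda>\<omega>. (2 * D\<^sup>2 * (A + sqrt (Y \<omega>) / D) - N \<omega>) / real k)"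
  have k0: "real k > 0"
    using k by simp
  have Y: "integrable M Y" "expectation Y \<le> 4 * real k * \<sigma>\<^sup>2"
    unfolding Y_def by (rule integrable_noise_increments, rule integral_noise_increments)
  have "0 \<le> Y \<omega>" for \<omega>
    by (simp add: Y_def sum_nonneg)
  note sqrtY = expectation_sqrt_le[OF Y(1) this]
  have N: "integrable M N" "expectation N = 0"
    unfolding N_def by (rule integrable_regret_noise[OF y], rule integral_regret_noise[OF y])
  have U: "integrable M U"
    unfolding U_def using sqrtY(1) N(1) by simp
  have gap: "G \<omega> - F y \<le> U \<omega>" if \<omega>: "\<omega> \<in> space M" for \<omega>
  proof -
    have "real k * (G \<omega> - F y) \<le> 2 * D\<^sup>2 * H k \<omega> - N \<omega>"
      unfolding G_def N_def using F_usgm_average_le[OF \<omega> k] regret[OF \<omega> y] by (rule order.trans)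
    also have "\<dots> \<le> 2 * D\<^sup>2 * (A + sqrt (Y \<omega>) / D) - N \<omega>"
      unfolding A_def L_def Y_def using H_bound[OF \<omega> \<nu> fin] by (intro diff_right_mono mult_left_mono) auto
    finally show ?thesis
      unfolding U_def using k0 by (simp add: pos_le_divide_eq mult.commute)
  qed
  have low: "F y \<le> G \<omega>" if "\<omega> \<in> space M" for \<omega>
    unfolding G_def by (intro min usgm_average_dom that k)
  have "integrable M (\<lambda>\<omega>. G \<omega> - F y)"
  proof (rule Bochner_Integration.integrable_bound[OF U])
    show "(\<lambda>\<omega>. G \<omega> - F y) \<in> borel_measurable M"
      unfolding G_def by (intro borel_measurable_diff F_usgm_average_measurable borel_measurable_const)
    show "AE \<omega> in M. norm (G \<omega> - F y) \<le> norm (U \<omega>)"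
      using gap low by (intro AE_I2) fastforce
  qed
  from Bochner_Integration.integrable_add[OF this, of "\<lambda>_. F y"]
  have G: "integrable M G"
    by simp
  then show "integrable M (\<lambda>\<omega>. F (usgm_average X k \<omega>))"
    by (simp add: G_def)
  have "expectation G - F y = expectation (\<lambda>\<omega>. G \<omega> - F y)"
    using G by (simp add: prob_space)
  also have "\<dots> \<le> expectation U"
    using G U gap by (intro integral_mono) auto
  also have "\<dots> = (2 * D\<^sup>2 * (A + expectation (\<lambda>\<omega>. sqrt (Y \<omega>)) / D)) / real k"
    unfolding U_def using sqrtY(1) N by (simp add: prob_space)
  also have "\<dots> \<le> (2 * D\<^sup>2 * (A + 2 * sqrt (real k) * \<sigma> / D)) / real k"
  proof -
    have "expectation (\<lambda>\<omega>. sqrt (Y \<omega>)) \<le> sqrt (4 * real k * \<sigma>\<^sup>2)"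
      using sqrtY(2) Y(2) by (meson order.trans real_sqrt_le_mono)
    also have "\<dots> = 2 * sqrt (real k) * \<sigma>"
      by (simp add: real_sqrt_mult oracle_sigma_nonneg)
    finally show ?thesis
      using D_pos by (intro divide_right_mono mult_left_mono add_left_mono) auto
  qed
  \<comment> \<open>Here \<open>8 = 2 * 4\<close> and \<open>4 = 2 * 2\<close>; the powers of
    \<open>D\<close> and of \<open>k\<close> are collected in the next three steps.\<close>
  also have "\<dots> = 8 * L * (D\<^sup>2 * D powr (\<nu> - 1)) * (real k powr ((1 - \<nu>) / 2) / real k)
      + 4 * \<sigma> * D * (sqrt (real k) / real k)"
    using D_pos k0 by (simp add: A_def field_simps power2_eq_square)
  also have "D\<^sup>2 * D powr (\<nu> - 1) = D powr (1 + \<nu>)"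
  proof -
    have "D\<^sup>2 * D powr (\<nu> - 1) = D powr (2 + (\<nu> - 1))"
      unfolding powr_add using D_pos by (simp add: powr_numeral)
    then show ?thesis
      by (simp add: add.commute)
  qed
  also have "real k powr ((1 - \<nu>) / 2) / real k = 1 / real k powr ((1 + \<nu>) / 2)"
  proof -
    have "real k powr ((1 - \<nu>) / 2) * real k powr ((1 + \<nu>) / 2) = real k powr 1"
      unfolding powr_add[symmetric] by (simp add: field_simps)
    then show ?thesis
      using k0 by (simp add: field_simps)
  qed
  also have "sqrt (real k) / real k = 1 / sqrt (real k)"
    using k0 by (simp add: sqrt_divide_self_eq inverse_eq_divide)
  finally show "expectation (\<lambda>\<omega>. F (usgm_average X k \<omega>)) - F y
      \<le> 8 * enn2real (hoelder_const B f \<psi> \<nu>) * D powr (1 + \<nu>) / real k powr ((1 + \<nu>) / 2)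
        + 4 * \<sigma> * D / sqrt (real k)"
    by (simp add: G_def L_def)
qed

end

section \<open>From the rate to the number of oracle calls\<close>

text \<open>Raising the assumption to the power \<open>q = (1 + \<nu>) / 2\<close> inverts the rate.
  The constant \<open>128 powr q\<close> is smallest at \<open>\<nu> = 0\<close>, where
  \<open>sqrt 128 \<ge> 32 / 3\<close>, and \<open>8 / (32 / 3) = 3 / 4\<close>.\<close>

lemma complexity_hoelder_term:
  fixes l D \<epsilon> \<nu> k :: real
  assumes l: "0 \<le> l" and D: "0 < D" and \<epsilon>: "0 < \<epsilon>" and \<nu>: "0 \<le> \<nu>" "\<nu> \<le> 1" and k: "0 < k"
    and small: "(l / \<epsilon>) powr (2 / (1 + \<nu>)) * D\<^sup>2 \<le> k / 128"
  shows "8 * l * D powr (1 + \<nu>) / k powr ((1 + \<nu>) / 2) \<le> 3 / 4 * \<epsilon>"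
proof -
  define q where "q = (1 + \<nu>) / 2"
  have q: "1 / 2 \<le> q" "2 / (1 + \<nu>) * q = 1" "1 + \<nu> = 2 * q"
    using \<nu> by (auto simp: q_def)
  have "((l / \<epsilon>) powr (2 / (1 + \<nu>)) * D\<^sup>2) powr q \<le> (k / 128) powr q"
    using small q \<nu> by (intro powr_mono2) auto
  also have "\<dots> = k powr q / 128 powr q"
    using k by (simp add: powr_divide)
  also have "((l / \<epsilon>) powr (2 / (1 + \<nu>)) * D\<^sup>2) powr q = l / \<epsilon> * D powr (1 + \<nu>)"
  proof -
    have "(D\<^sup>2) powr q = D powr (1 + \<nu>)"
      using D by (simp add: q(3) powr_powr flip: powr_numeral)
    moreover have "((l / \<epsilon>) powr (2 / (1 + \<nu>))) powr q = l / \<epsilon>"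
      unfolding powr_powr q(2) using l \<epsilon> by simp
    ultimately show ?thesis
      by (simp add: powr_mult)
  qed
  finally have "l * D powr (1 + \<nu>) \<le> \<epsilon> * (k powr q / 128 powr q)"
    using \<epsilon> by (simp add: field_simps)
  moreover have "32 / 3 \<le> (128 :: real) powr q"
  proof -
    have "32 / 3 \<le> sqrt 128"
      by (rule real_le_rsqrt) (simp add: power2_eq_square)
    also have "\<dots> = 128 powr (1 / 2)"
      by (simp add: powr_half_sqrt)
    also have "\<dots> \<le> 128 powr q"
      using q by (intro powr_mono) auto
    finally show ?thesis .
  qed
  then have "k powr q / 128 powr q \<le> k powr q / (32 / 3)"
    using k by (intro divide_left_mono) auto
  then have "\<epsilon> * (k powr q / 128 powr q) \<le> \<epsilon> * (k powr q / (32 / 3))"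
    using \<epsilon> by (intro mult_left_mono) auto
  ultimately have "l * D powr (1 + \<nu>) \<le> \<epsilon> * (k powr q / (32 / 3))"
    by (rule order.trans)
  then have "8 * l * D powr (1 + \<nu>) \<le> 3 / 4 * \<epsilon> * k powr q"
    by simp
  then show ?thesis
    using k by (simp add: pos_divide_le_eq q_def)
qed

lemma complexity_noise_term:
  fixes D \<epsilon> \<sigma> k :: real
  assumes "0 < D" and \<epsilon>: "0 < \<epsilon>" and k: "0 < k" and "0 \<le> \<sigma>" and small: "256 * (\<sigma>\<^sup>2 * D\<^sup>2 / \<epsilon>\<^sup>2) \<le> k"
  shows "4 * \<sigma> * D / sqrt k \<le> \<epsilon> / 4"
proof -
  have "(16 * \<sigma> * D / \<epsilon>)\<^sup>2 \<le> k"
    using small by (simp add: power_mult_distrib power_divide)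
  then have "16 * \<sigma> * D / \<epsilon> \<le> sqrt k"
    by (rule real_le_rsqrt)
  then show ?thesis
    using \<epsilon> k by (simp add: field_simps)
qed

text \<open>The absolute constant hidden in \<open>O\<close> is made explicit as 512.\<close>

theorem theorem4p2:
  fixes B :: "real^'n^'n"
    and f \<psi> :: "real^'n \<Rightarrow> ereal"
    and D :: real
    and P :: "'z measure" and g :: "real^'n \<Rightarrow> 'z \<Rightarrow> real^'n"
    and M :: "'w measure"
    and Z :: "nat \<Rightarrow> 'w \<Rightarrow> 'z" and X :: "nat \<Rightarrow> 'w \<Rightarrow> real^'n"
    and x0 :: "real^'n"
  assumes "spd_matrix B"
    and "composite_problem f \<psi>"
    and "D > 0" and "\<forall>x\<in>edom \<psi>. \<forall>y\<in>edom \<psi>. pnorm B (x - y) \<le> D"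
    and "\<exists>\<nu>\<in>{0..1}. hoelder_const B f \<psi> \<nu> < \<infinity>"
    and "unbiased_oracle f \<psi> P g" and "oracle_variance B \<psi> P g < \<infinity>"
    and "prob_space M"
    and "fresh_samples M P Z X"
    and "x0 \<in> edom \<psi>"
    and "\<forall>\<omega>\<in>space M. usgm_trajectory B \<psi> D x0 (\<lambda>k. X k \<omega>) (\<lambda>k. g (X k \<omega>) (Z k \<omega>))"
  shows "(\<exists>x\<in>edom \<psi>. objective f \<psi> x = opt_value f \<psi>)
    \<and> (\<forall>k\<ge>1.
         integrable M (\<lambda>\<omega>. real_of_ereal (objective f \<psi> (usgm_average X k \<omega>))) \<and>
         ereal (\<integral>\<omega>. real_of_ereal (objective f \<psi> (usgm_average X k \<omega>)) \<partial>M) - opt_value f \<psi>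
         \<le> enn2ereal
             ((INF \<nu>\<in>{0..1}. 8 * hoelder_const B f \<psi> \<nu> * ennreal (D powr (1 + \<nu>))
                               / ennreal (real k powr ((1 + \<nu>) / 2)))
              + ennreal (4 * oracle_sigma B \<psi> P g * D / sqrt (real k))))
    \<and> (\<forall>\<epsilon>>0. \<forall>k\<ge>1.
         512 * ((INF \<nu>\<in>{0..1}. ennreal_powr (hoelder_const B f \<psi> \<nu> / ennreal \<epsilon>) (2 / (1 + \<nu>))
                                 * ennreal (D\<^sup>2))
                + ennreal ((oracle_sigma B \<psi> P g)\<^sup>2 * D\<^sup>2 / \<epsilon>\<^sup>2))
           \<le> ennreal (real (usgm_calls k)) \<longrightarrow>
         ereal (\<integral>\<omega>. real_of_ereal (objective f \<psi> (usgm_average X k \<omega>)) \<partial>M) - opt_value f \<psi>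
         \<le> ereal \<epsilon>)"
proof -
  have X_dom: "X k \<omega> \<in> edom \<psi>" if "\<omega> \<in> space M" for k \<omega>
  proof (cases k)
    case 0
    then show ?thesis
      using assms(10,11) that by (simp add: usgm_trajectory_def)
  next
    case (Suc j)
    then show ?thesis
      using assms(11) that by (simp add: usgm_trajectory_def is_arg_min_def)
  qed
  interpret usgm_run M B f \<psi> P g Z X D x0
    by (intro usgm_run.intro oracle_run.intro oracle_run_axioms.intro usgm_run_axioms.intro;
        use assms(1-4,6-9,11) X_dom in blast)
  obtain y where y: "y \<in> edom \<psi>" and opt: "objective f \<psi> y = opt_value f \<psi>"
    using composite_problem_attains[OF problem bounded_of_pnorm_diam[OF spd assms(4)]] by blast
  have opt_eq: "opt_value f \<psi> = ereal (F y)"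
    unfolding opt[symmetric] by (simp add: composite_problem_finite(4)[OF problem y])
  have min: "F y \<le> F x" if x: "x \<in> edom \<psi>" for x
  proof -
    have "opt_value f \<psi> \<le> objective f \<psi> x"
      unfolding opt_value_def using x by (rule INF_lower)
    then show ?thesis
      by (simp add: opt_eq composite_problem_finite(4)[OF problem x])
  qed
  define gap where "gap = (\<lambda>k. expectation (\<lambda>\<omega>. F (usgm_average X k \<omega>)) - F y)"
  have gap: "ereal (expectation (\<lambda>\<omega>. F (usgm_average X k \<omega>))) - opt_value f \<psi> = ereal (gap k)" for k
    by (simp add: gap_def opt_eq)
  have gap_le: "gap k \<le> 8 * enn2real (hoelder_const B f \<psi> \<nu>) * D powr (1 + \<nu>) / real k powr ((1 + \<nu>) / 2)
        + 4 * \<sigma> * D / sqrt (real k)"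
    if "k \<ge> 1" "\<nu> \<in> {0..1}" "hoelder_const B f \<psi> \<nu> < \<infinity>" for k \<nu>
    unfolding gap_def using that by (intro expected_gap_le[OF y min]) auto
  \<comment> \<open>Integrability does not depend on \<nu>, so any exponent with a finite Hoelder
    constant serves.\<close>
  have int: "integrable M (\<lambda>\<omega>. F (usgm_average X k \<omega>))" if "k \<ge> 1" for k
    using assms(5) that by (auto intro: integrable_F_usgm_average[OF y min])
  have gap_nonneg: "0 \<le> gap k" if k: "k \<ge> 1" for k
    unfolding gap_def using min usgm_average_dom k
    by (simp add: integral_ge_const[OF int[OF k]])
  have "ereal (gap k) \<le> enn2ereal
             ((INF \<nu>\<in>{0..1}. 8 * hoelder_const B f \<psi> \<nu> * ennreal (D powr (1 + \<nu>))
                               / ennreal (real k powr ((1 + \<nu>) / 2)))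
              + ennreal (4 * \<sigma> * D / sqrt (real k)))" (is "_ \<le> enn2ereal (?I + ennreal ?b)")
    if k: "k \<ge> 1" for k
  proof -
    have b: "0 \<le> ?b"
      using D_pos oracle_sigma_nonneg by simp
    \<comment> \<open>The noise term is moved to the left before the infimum is taken. If the
      difference is negative, \<open>ennreal\<close> truncates it to 0, which only weakens the
      claim; adding \<open>?b\<close> back is then checked by cases.\<close>
    have "ennreal (gap k - ?b) \<le> ?I"
    proof (rule INF_greatest)
      fix \<nu> :: real
      assume \<nu>: "\<nu> \<in> {0..1}"
      show "ennreal (gap k - ?b) \<le> 8 * hoelder_const B f \<psi> \<nu> * ennreal (D powr (1 + \<nu>))
                               / ennreal (real k powr ((1 + \<nu>) / 2))"
      proof (cases "hoelder_const B f \<psi> \<nu> < \<infinity>")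
        case True
        define l where "l = enn2real (hoelder_const B f \<psi> \<nu>)"
        have l: "hoelder_const B f \<psi> \<nu> = ennreal l" "0 \<le> l"
          using True by (simp_all add: l_def)
        have "8 * hoelder_const B f \<psi> \<nu> * ennreal (D powr (1 + \<nu>)) / ennreal (real k powr ((1 + \<nu>) / 2))
            = ennreal (8 * l * D powr (1 + \<nu>) / real k powr ((1 + \<nu>) / 2))"
        proof -
          have "8 * hoelder_const B f \<psi> \<nu> * ennreal (D powr (1 + \<nu>)) = ennreal (8 * l * D powr (1 + \<nu>))"
            using l(2) by (simp add: l(1) ennreal_mult)
          then show ?thesis
            using k l(2) by (simp add: divide_ennreal)
        qed
        moreover have "gap k - ?b \<le> 8 * l * D powr (1 + \<nu>) / real k powr ((1 + \<nu>) / 2)"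
          using gap_le[OF k \<nu> True] by (simp add: l_def)
        ultimately show ?thesis
          by (simp add: ennreal_leI)
      next
        case False
        \<comment> \<open>The right side is infinite: \<open>D powr (1 + \<nu>)\<close> is positive,
          so the convention \<open>\<infinity> * 0 = 0\<close> does not interfere.\<close>
        then have "hoelder_const B f \<psi> \<nu> = \<top>"
          by (simp add: less_top[symmetric])
        then show ?thesis
          using D_pos by (simp add: ennreal_mult_top ennreal_top_mult ennreal_top_divide)
      qed
    qed
    then have "ennreal (gap k - ?b) + ennreal ?b \<le> ?I + ennreal ?b"
      by (rule add_right_mono)
    moreover have "ennreal (gap k) \<le> ennreal (gap k - ?b) + ennreal ?b"
    proof (cases "?b \<le> gap k")
      case True
      then show ?thesis
        using b ennreal_plus[of "gap k - ?b" ?b] by simp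
    next
      case False
      then show ?thesis
        by (intro add_increasing ennreal_leI) auto
    qed
    ultimately have "ennreal (gap k) \<le> ?I + ennreal ?b"
      by (rule order.trans[rotated])
    then have "enn2ereal (ennreal (gap k)) \<le> enn2ereal (?I + ennreal ?b)"
      by (simp flip: less_eq_ennreal.rep_eq)
    then show ?thesis
      using gap_nonneg[OF k] by (simp add: enn2ereal_ennreal)
  qed
  moreover have "gap k \<le> \<epsilon>"
    if \<epsilon>: "\<epsilon> > 0" and k: "k \<ge> 1"
      and calls: "512 * ((INF \<nu>\<in>{0..1}. ennreal_powr (hoelder_const B f \<psi> \<nu> / ennreal \<epsilon>) (2 / (1 + \<nu>))
                                 * ennreal (D\<^sup>2))
                + ennreal (\<sigma>\<^sup>2 * D\<^sup>2 / \<epsilon>\<^sup>2)) \<le> ennreal (real (usgm_calls k))"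
        (is "512 * (?I + ennreal ?s) \<le> _")
    for \<epsilon> k
  proof -
    have "512 * ennreal ?s \<le> 512 * (?I + ennreal ?s)"
      by (intro mult_left_mono) auto
    also note calls
    finally have "ennreal (512 * ?s) \<le> ennreal (real (usgm_calls k))"
      using ennreal_mult'[of 512 ?s] by (simp only: ennreal_numeral)
    then have "512 * ?s \<le> real (usgm_calls k)"
      by (rule ennreal_le_iff[THEN iffD1, rotated]) simp
    then have "512 * ?s \<le> real k + 1"
      by (simp add: usgm_calls_def)
    \<comment> \<open>One call belongs to the initialisation; \<open>k + 1 \<le> 2 * k\<close> turns
      512 into 256, which makes the noise term at most \<open>\<epsilon> / 4\<close> and leaves
      \<open>3 / 4 * \<epsilon>\<close> for the other.\<close>
    then have s: "256 * ?s \<le> real k"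
      using k by simp
    have "512 * ?I \<le> 512 * (?I + ennreal ?s)"
      by (intro mult_left_mono) auto
    also note calls
    finally have I: "512 * ?I \<le> ennreal (real (usgm_calls k))" .
    \<comment> \<open>Strictness is essential: the infimum need not be attained, but some exponent
      lies below any larger value. With \<open>k / 128\<close> the contradiction is
      \<open>4 * k \<le> k + 1\<close>; with \<open>k / 256\<close> it would fail at
      \<open>k = 1\<close>.\<close>
    have "?I < ennreal (real k / 128)"
    proof (rule ccontr)
      assume "\<not> ?thesis"
      then have "512 * ennreal (real k / 128) \<le> 512 * ?I"
        by (intro mult_left_mono) auto
      also note I
      finally have "ennreal (512 * (real k / 128)) \<le> ennreal (real (usgm_calls k))"
        using ennreal_mult'[of 512 "real k / 128"] by (simp only: ennreal_numeral)
      then have "512 * (real k / 128) \<le> real (usgm_calls k)"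
        by (rule ennreal_le_iff[THEN iffD1, rotated]) simp
      then show False
        using k by (simp add: usgm_calls_def)
    qed
    then obtain \<nu> where \<nu>: "\<nu> \<in> {0..1}"
      and less: "ennreal_powr (hoelder_const B f \<psi> \<nu> / ennreal \<epsilon>) (2 / (1 + \<nu>)) * ennreal (D\<^sup>2)
        < ennreal (real k / 128)"
      by (auto simp: INF_less_iff)
    have fin: "hoelder_const B f \<psi> \<nu> < \<infinity>"
    proof (rule ccontr)
      assume "\<not> ?thesis"
      then have "hoelder_const B f \<psi> \<nu> = \<top>"
        by (simp add: less_top[symmetric])
      then show False
        using less D_pos by (simp add: ennreal_powr_def ennreal_top_divide ennreal_top_mult)
    qed
    define l where "l = enn2real (hoelder_const B f \<psi> \<nu>)"
    have l: "hoelder_const B f \<psi> \<nu> = ennreal l" "0 \<le> l"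
      using fin by (simp_all add: l_def)
    have "ennreal ((l / \<epsilon>) powr (2 / (1 + \<nu>)) * D\<^sup>2) < ennreal (real k / 128)"
      using less l(2) \<epsilon> by (simp add: l(1) divide_ennreal ennreal_powr_def ennreal_mult)
    then have "(l / \<epsilon>) powr (2 / (1 + \<nu>)) * D\<^sup>2 \<le> real k / 128"
      by (subst (asm) ennreal_less_iff) auto
    then have "8 * l * D powr (1 + \<nu>) / real k powr ((1 + \<nu>) / 2) \<le> 3 / 4 * \<epsilon>"
      using \<nu> k by (intro complexity_hoelder_term l D_pos \<epsilon>) auto
    moreover have "4 * \<sigma> * D / sqrt (real k) \<le> \<epsilon> / 4"
      using k s by (intro complexity_noise_term D_pos \<epsilon> oracle_sigma_nonneg) auto
    ultimately show ?thesis
      using gap_le[OF k \<nu> fin] by (simp add: l_def)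
  qed
  ultimately show ?thesis
    using y opt int by (auto simp: gap)
qed

end
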